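(* Let $n\ge3$ be an integer (bounded or not) and $q$ a prime power with $q\to\infty$. Let $X$ be the random subset of $\mathbb{F}_q^n$ containing each element independently with probability $\theta$. Let $\ell$ and $m$ be bounded positive integers (with $m<n$). Then the event $\Gamma=\Gamma(\theta;\ell)$ that there is an $\ell$-rich $m$-flat in $\mathbb{F}_q^n$ with respect to $X$ has threshold function $\left(q^{(n-m)(m+1)+m\ell}\right)^{-1/\ell}$.
   Context: An $m$-flat in $\mathbb{F}_q^n$ is a translate of an $m$-dimensional linear subspace; it is $\ell$-rich with respect to $X$ if it contains at least $\ell$ points of $X$. A function $t$ is a threshold function for $\Gamma$ if $\Pr[\Gamma]\to0$ whenever $\theta=o(t)$ and $\Pr[\Gamma]\to1$ whenever $\theta=\omega(t)$.
   Formalization: The formal theorem additionally assumes ℓ > m; for ℓ ≤ m any ℓ points lie on an m-flat, the true threshold is q^{-n}, and the stated function is not a threshold (e.g. n=3, m=ℓ=1, θ=q^{-4}). *)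

theory Defs
  imports
    "HOL-Probability.Probability"
    "HOL-Library.Landau_Symbols"
    "HOL-Number_Theory.Prime_Powers"
    "Jordan_Normal_Form.Missing_VectorSpace"
begin

text \<open>
  The coordinate space $F^n$, as the module of extensional functions \<open>{..<n} \<rightarrow>\<^sub>E carrier F\<close>.
  Fields are records rather than types so that a statement can involve a sequence of fields
  and of dimensions.
\<close>
definition coord_space :: "('a, 'b) ring_scheme \<Rightarrow> nat \<Rightarrow> ('a, nat \<Rightarrow> 'a) module" where
  "coord_space F n = LinearCombinations.ring.func_space F {..<n}"

definition is_flat :: "('a, 'b) ring_scheme \<Rightarrow> nat \<Rightarrow> nat \<Rightarrow> (nat \<Rightarrow> 'a) set \<Rightarrow> bool" where
  "is_flat F n m S \<longleftrightarrow>
     (\<exists>W v. VectorSpace.subspace F W (coord_space F n)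
          \<and> vectorspace.dim F ((coord_space F n)\<lparr>carrier := W\<rparr>) = m
          \<and> v \<in> carrier (coord_space F n)
          \<and> S = (\<lambda>w. v \<oplus>\<^bsub>coord_space F n\<^esub> w) ` W)"

text \<open>
  Any \<open>l \<le> m\<close> points lie on a common \<open>m\<close>-flat, so in that range an \<open>l\<close>-rich \<open>m\<close>-flat exists as
  soon as the random set has \<open>l\<close> points: the threshold is then \<open>q\<close> to the power \<open>-n\<close>, which is
  strictly larger than the function in the theorem.  Hence its assumption \<open>m < l\<close>.
\<close>
definition rich :: "nat \<Rightarrow> 'v set \<Rightarrow> 'v set \<Rightarrow> bool" where
  "rich l X S \<longleftrightarrow> l \<le> card (S \<inter> X)"

definition random_subset :: "'v set \<Rightarrow> real \<Rightarrow> 'v set pmf" where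
  "random_subset A \<theta> = map_pmf (\<lambda>f. {x \<in> A. f x}) (Pi_pmf A False (\<lambda>_. bernoulli_pmf \<theta>))"

definition prob_rich_flat :: "('a, 'b) ring_scheme \<Rightarrow> nat \<Rightarrow> nat \<Rightarrow> nat \<Rightarrow> real \<Rightarrow> real" where
  "prob_rich_flat F n m l \<theta> =
     measure_pmf.prob (random_subset (carrier (coord_space F n)) \<theta>)
       {X. \<exists>S. is_flat F n m S \<and> rich l X S}"

text \<open>
  \<open>Pr k \<theta>\<close> is the probability of the event at stage \<open>k\<close> of the limiting process when points
  are chosen with probability \<open>\<theta>\<close>.  The bounds \<open>0 \<le> \<theta> k \<le> 1\<close> are needed because
  \<^const>\<open>bernoulli_pmf\<close> clamps its parameter to the unit interval.
\<close>
definition threshold_function :: "(nat \<Rightarrow> real \<Rightarrow> real) \<Rightarrow> (nat \<Rightarrow> real) \<Rightarrow> bool" where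
  "threshold_function Pr t \<longleftrightarrow>
     (\<forall>\<theta>. (\<forall>k. 0 \<le> \<theta> k \<and> \<theta> k \<le> 1) \<longrightarrow>
        (\<theta> \<in> o(t) \<longrightarrow> (\<lambda>k. Pr k (\<theta> k)) \<longlonglongrightarrow> 0) \<and>
        (\<theta> \<in> \<omega>(t) \<longrightarrow> (\<lambda>k. Pr k (\<theta> k)) \<longlonglongrightarrow> 1))"

end

theory Submission
  imports Defs
begin

text \<open>
  An \<open>l\<close>-subset of an \<open>m\<close>-flat lies in the affine hull of \<open>m + 1\<close> of its points, so there are
  at most \<open>q^(n * (m + 1)) * q^(m * (l - m - 1))\<close> such sets; this is the number in the theorem,
  and the union bound handles small \<open>\<theta>\<close> without counting flats.  For large \<open>\<theta>\<close> the second
  moment method is applied to the sets \<open>{(x, f x) | x \<in> P}\<close>, where \<open>f\<close> ranges over the affine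
  maps from \<open>m\<close>-space to \<open>(n - m)\<close>-space and \<open>P\<close> over the \<open>l\<close>-subsets of \<open>m\<close>-space on which
  no nonzero affine functional has more than \<open>m\<close> zeros.  For large \<open>q\<close> a constant proportion of
  the \<open>l\<close>-subsets has this property, and prescribing \<open>j\<close> points of the graph leaves at most
  \<open>q^(m + 1 - j)\<close> choices (one, if \<open>j > m\<close>) for each coordinate of \<open>f\<close>.
\<close>

section \<open>Second moments of random subsets\<close>

lemma card_subsets_le_power:
  assumes "finite A" and "card A \<le> D"
  shows "card {C. C \<subseteq> A \<and> card C = r} \<le> D ^ r"
proof -
  have "card {C. C \<subseteq> A \<and> card C = r} = card A choose r"
    using n_subsets[OF assms(1)] by simp
  also have "\<dots> \<le> card A ^ r"
    by (cases "r \<le> card A") (auto intro: binomial_le_pow simp: binomial_eq_0)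
  also have "\<dots> \<le> D ^ r"
    using assms(2) by (rule power_mono) simp
  finally show ?thesis .
qed

text \<open>Given \<open>i\<close>, the set \<open>P\<close> is recovered from
  \<open>P - B i\<close>, which has \<open>l - k\<close> elements inside \<open>h i\<close>. The
  later upper bounds for families of point sets rest on this: a core of chosen points, then the
  remaining points anywhere in a small hull.\<close>

lemma card_intermediate_sets_le:
  assumes "finite I"
    and B: "\<And>i. i \<in> I \<Longrightarrow> finite (B i) \<and> card (B i) = k"
    and h: "\<And>i. i \<in> I \<Longrightarrow> finite (h i) \<and> card (h i) \<le> D"
  shows "card {P. card P = l \<and> (\<exists>i\<in>I. B i \<subseteq> P \<and> P \<subseteq> h i)} \<le> card I * D ^ (l - k)"
proof -
  let ?S = "\<lambda>i. {P. card P = l \<and> B i \<subseteq> P \<and> P \<subseteq> h i}"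
  have "card (?S i) \<le> D ^ (l - k)" if i: "i \<in> I" for i
  proof -
    have "card (?S i) \<le> card {C. C \<subseteq> h i \<and> card C = l - k}"
    proof (rule card_inj_on_le[where f = "\<lambda>P. P - B i"])
      show "inj_on (\<lambda>P. P - B i) (?S i)"
        by (rule inj_onI) blast
      show "(\<lambda>P. P - B i) ` ?S i \<subseteq> {C. C \<subseteq> h i \<and> card C = l - k}"
        using B[OF i] by (auto simp: card_Diff_subset)
      show "finite {C. C \<subseteq> h i \<and> card C = l - k}"
        using h[OF i] by simp
    qed
    also have "\<dots> \<le> D ^ (l - k)"
      using h[OF i] by (intro card_subsets_le_power) auto
    finally show ?thesis .
  qed
  then have "(\<Sum>i\<in>I. card (?S i)) \<le> card I * D ^ (l - k)"
    using sum_bounded_above[of I "\<lambda>i. card (?S i)" "D ^ (l - k)"] by simp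
  moreover have "{P. card P = l \<and> (\<exists>i\<in>I. B i \<subseteq> P \<and> P \<subseteq> h i)} = (\<Union>i\<in>I. ?S i)"
    by auto
  ultimately show ?thesis
    using card_UN_le[OF \<open>finite I\<close>, of ?S] by simp
qed

section \<open>Inclusion probabilities and the variance of the count\<close>

lemma set_pmf_random_subset:
  "set_pmf (random_subset A \<theta>) \<subseteq> Pow A"
  by (auto simp: random_subset_def)

lemma integrable_random_subset [simp]:
  fixes f :: "'v set \<Rightarrow> real"
  assumes "finite A"
  shows "integrable (measure_pmf (random_subset A \<theta>)) f"
  using finite_subset[OF set_pmf_random_subset] assms
  by (intro integrable_measure_pmf_finite) auto

lemma prob_random_subset_superset:
  assumes "finite A" and "T \<subseteq> A" and "0 \<le> \<theta>" and "\<theta> \<le> 1"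
  shows "measure_pmf.prob (random_subset A \<theta>) {X. T \<subseteq> X} = \<theta> ^ card T"
proof -
  let ?B = "\<lambda>x. if x \<in> T then {True} else UNIV"
  have "(\<lambda>f. {x \<in> A. f x}) -` {X. T \<subseteq> X} = Pi A ?B"
    using assms(2) by (auto simp: Pi_iff split: if_splits)
  then have "measure_pmf.prob (random_subset A \<theta>) {X. T \<subseteq> X} =
      (\<Prod>x\<in>A. measure_pmf.prob (bernoulli_pmf \<theta>) (?B x))"
    unfolding random_subset_def using assms(1) by (simp add: measure_Pi_pmf_Pi)
  also have "\<dots> = (\<Prod>x\<in>A. if x \<in> T then \<theta> else 1)"
    using assms(3,4) by (intro prod.cong) (auto simp: measure_pmf_single)
  also have "\<dots> = \<theta> ^ card T"
    using assms(1,2) by (simp add: prod.If_cases Int_absorb1)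
  finally show ?thesis .
qed

text \<open>
  The bound is \<open>Var Y / (E Y)\<^sup>2\<close> for the number \<open>Y\<close> of indices \<open>i\<close> with \<open>T i \<subseteq> X\<close>; the pairs
  \<open>(i, i')\<close> contributing to the variance are grouped by \<open>J = T i \<inter> T i'\<close>.
\<close>
lemma second_moment_bound:
  fixes T :: "'i \<Rightarrow> 'v set" and D :: "nat \<Rightarrow> nat"
  assumes A: "finite A" and I: "finite I" "I \<noteq> {}"
    and T: "\<And>i. i \<in> I \<Longrightarrow> T i \<subseteq> A" "\<And>i. i \<in> I \<Longrightarrow> card (T i) = l"
    and \<theta>: "0 < \<theta>" "\<theta> \<le> 1"
    and D: "\<And>J. J \<subseteq> A \<Longrightarrow> card {i \<in> I. J \<subseteq> T i} \<le> D (card J)"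
  shows "1 - measure_pmf.prob (random_subset A \<theta>) {X. \<exists>i\<in>I. T i \<subseteq> X}
    \<le> (\<Sum>j=1..l. real (l choose j) * real (D j) / (\<theta> ^ j * real (card I)))"
proof -
  define p where "p = random_subset A \<theta>"
  define E :: "('v set \<Rightarrow> real) \<Rightarrow> real" where "E = measure_pmf.expectation p"
  define ind where "ind i = indicat_real {X. T i \<subseteq> X}" for i
  define Y where "Y X = (\<Sum>i\<in>I. ind i X)" for X
  define \<mu> where "\<mu> = real (card I) * \<theta> ^ l"
  define N where "N = real (card I)"
  have N: "N > 0" using I by (simp add: N_def card_gt_0_iff)
  have \<mu>: "\<mu> > 0" using N \<theta> by (simp add: \<mu>_def N_def)
  have int: "integrable (measure_pmf p) f" for f :: "'v set \<Rightarrow> real"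
    unfolding p_def using A by simp
  have fT: "finite (T i)" if "i \<in> I" for i
    using T(1)[OF that] A finite_subset by blast
  have EY: "E Y = \<mu>"
  proof -
    have "E Y = (\<Sum>i\<in>I. E (ind i))"
      unfolding E_def Y_def using int by simp
    also have "\<dots> = (\<Sum>i\<in>I. \<theta> ^ l)"
      using T \<theta> A prob_random_subset_superset[of A _ \<theta>]
      by (intro sum.cong) (auto simp: E_def ind_def p_def)
    finally show ?thesis by (simp add: \<mu>_def)
  qed
  \<comment> \<open>For fixed \<open>i\<close>, the indices \<open>i'\<close> with
    \<open>T i'\<close> disjoint from \<open>T i\<close> give at most
    \<open>N * \<theta> ^ (2 * l)\<close>. Summed over \<open>i\<close> this is the square of the
    mean \<open>\<mu>\<close>, which cancels in the variance and leaves only the terms with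
    \<open>j \<ge> 1\<close>.\<close>
  have row: "(\<Sum>i'\<in>I. \<theta> ^ card (T i \<union> T i')) \<le>
      N * \<theta> ^ (2 * l) + (\<Sum>j=1..l. real (l choose j) * real (D j) * \<theta> ^ (2 * l - j))"
    if i: "i \<in> I" for i
  proof -
    have "(\<Sum>i'\<in>I. \<theta> ^ card (T i \<union> T i')) = (\<Sum>i'\<in>I. \<theta> ^ (2 * l - card (T i \<inter> T i')))"
    proof (rule sum.cong)
      fix i' assume i': "i' \<in> I"
      have "card (T i \<union> T i') = 2 * l - card (T i \<inter> T i')"
        using card_Un_Int[OF fT[OF i] fT[OF i']] T(2)[OF i] T(2)[OF i'] by simp
      then show "\<theta> ^ card (T i \<union> T i') = \<theta> ^ (2 * l - card (T i \<inter> T i'))" by simp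
    qed simp
    also have "\<dots> = (\<Sum>J\<in>Pow (T i). \<Sum>i'\<in>{i' \<in> I. T i \<inter> T i' = J}. \<theta> ^ (2 * l - card (T i \<inter> T i')))"
      using I fT[OF i] by (intro sum.group[symmetric]) auto
    also have "\<dots> = (\<Sum>J\<in>Pow (T i). real (card {i' \<in> I. T i \<inter> T i' = J}) * \<theta> ^ (2 * l - card J))"
      by (intro sum.cong) auto
    also have "\<dots> = real (card {i' \<in> I. T i \<inter> T i' = {}}) * \<theta> ^ (2 * l) +
        (\<Sum>J\<in>Pow (T i) - {{}}. real (card {i' \<in> I. T i \<inter> T i' = J}) * \<theta> ^ (2 * l - card J))"
      using fT[OF i] by (subst sum.remove[of _ "{}"]) auto
    \<comment> \<open>The exact condition \<open>T i \<inter> T i' = J\<close> is relaxed to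
      \<open>J \<subseteq> T i'\<close>, which is what \<open>D\<close> controls.\<close>
    also have "\<dots> \<le> N * \<theta> ^ (2 * l) +
        (\<Sum>J\<in>Pow (T i) - {{}}. real (D (card J)) * \<theta> ^ (2 * l - card J))"
    proof (intro add_mono sum_mono mult_right_mono)
      show "real (card {i' \<in> I. T i \<inter> T i' = {}}) \<le> N"
        unfolding N_def using I by (auto intro!: card_mono)
      fix J assume "J \<in> Pow (T i) - {{}}"
      then have "card {i' \<in> I. T i \<inter> T i' = J} \<le> card {i' \<in> I. J \<subseteq> T i'}" "J \<subseteq> A"
        using I T(1)[OF i] by (auto intro!: card_mono)
      then show "real (card {i' \<in> I. T i \<inter> T i' = J}) \<le> real (D (card J))"
        using D[of J] by simp
    qed (use \<theta> in auto)
    also have "(\<Sum>J\<in>Pow (T i) - {{}}. real (D (card J)) * \<theta> ^ (2 * l - card J)) =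
        (\<Sum>j=1..l. \<Sum>J\<in>{J \<in> Pow (T i) - {{}}. card J = j}. real (D (card J)) * \<theta> ^ (2 * l - card J))"
    proof (rule sum.group[symmetric])
      show "card ` (Pow (T i) - {{}}) \<subseteq> {1..l}"
        using card_mono[OF fT[OF i]] finite_subset[OF _ fT[OF i]] T(2)[OF i]
        by (fastforce simp: Suc_le_eq card_gt_0_iff)
    qed (use fT[OF i] in auto)
    also have "\<dots> = (\<Sum>j=1..l. real (l choose j) * real (D j) * \<theta> ^ (2 * l - j))"
    proof (rule sum.cong)
      fix j assume j: "j \<in> {1..l}"
      have "{J \<in> Pow (T i) - {{}}. card J = j} = {J. J \<subseteq> T i \<and> card J = j}"
        using j by auto
      then have "card {J \<in> Pow (T i) - {{}}. card J = j} = l choose j"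
        using n_subsets[OF fT[OF i]] T(2)[OF i] by simp
      then show "(\<Sum>J\<in>{J \<in> Pow (T i) - {{}}. card J = j}. real (D (card J)) * \<theta> ^ (2 * l - card J))
          = real (l choose j) * real (D j) * \<theta> ^ (2 * l - j)"
        by (simp add: sum.cong[where g = "\<lambda>_. real (D j) * \<theta> ^ (2 * l - j)"])
    qed simp
    finally show ?thesis by simp
  qed
  have "E (\<lambda>X. (Y X)\<^sup>2) = (\<Sum>i\<in>I. \<Sum>i'\<in>I. E (\<lambda>X. ind i X * ind i' X))"
    unfolding E_def Y_def power2_eq_square sum_product using int by simp
  also have "\<dots> = (\<Sum>i\<in>I. \<Sum>i'\<in>I. \<theta> ^ card (T i \<union> T i'))"
  proof (intro sum.cong refl)
    fix i i' assume ii': "i \<in> I" "i' \<in> I"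
    have "(\<lambda>X. ind i X * ind i' X) = indicat_real {X. T i \<union> T i' \<subseteq> X}"
      by (auto simp: ind_def indicator_def fun_eq_iff)
    then show "E (\<lambda>X. ind i X * ind i' X) = \<theta> ^ card (T i \<union> T i')"
      using prob_random_subset_superset[of A "T i \<union> T i'" \<theta>] T(1) ii' \<theta> A
      by (simp add: E_def p_def)
  qed
  also have "\<dots> \<le> N * (N * \<theta> ^ (2 * l) +
      (\<Sum>j=1..l. real (l choose j) * real (D j) * \<theta> ^ (2 * l - j)))"
    using sum_bounded_above[OF row] by (simp add: N_def)
  finally have EY2: "E (\<lambda>X. (Y X)\<^sup>2) \<le> \<mu>\<^sup>2 +
      N * (\<Sum>j=1..l. real (l choose j) * real (D j) * \<theta> ^ (2 * l - j))"
    by (simp add: \<mu>_def N_def power2_eq_square algebra_simps power_add[symmetric] mult_2_right)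
  have "1 - measure_pmf.prob p {X. \<exists>i\<in>I. T i \<subseteq> X} = measure_pmf.prob p {X. \<not> (\<exists>i\<in>I. T i \<subseteq> X)}"
    using measure_pmf.prob_compl[of "{X. \<exists>i\<in>I. T i \<subseteq> X}" p]
    by (simp add: Compl_eq_Diff_UNIV[symmetric] flip: Collect_neg_eq)
  also have "\<dots> = E (indicat_real {X. \<not> (\<exists>i\<in>I. T i \<subseteq> X)})"
    by (simp add: E_def)
  \<comment> \<open>Chebyshev's inequality: on the event in question \<open>Y\<close> is 0, so the
    quotient on the right equals 1 there.\<close>
  also have "\<dots> \<le> E (\<lambda>X. (Y X - \<mu>)\<^sup>2 / \<mu>\<^sup>2)"
    unfolding E_def
  proof (rule integral_mono[OF int int])
    fix X
    have "Y X = 0" if "\<not> (\<exists>i\<in>I. T i \<subseteq> X)"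
      unfolding Y_def using that by (intro sum.neutral) (auto simp: ind_def)
    then show "indicat_real {X. \<not> (\<exists>i\<in>I. T i \<subseteq> X)} X \<le> (Y X - \<mu>)\<^sup>2 / \<mu>\<^sup>2"
      using \<mu> by (auto simp: indicator_def)
  qed
  also have "\<dots> = (E (\<lambda>X. (Y X)\<^sup>2) - \<mu>\<^sup>2) / \<mu>\<^sup>2"
  proof -
    have "E (\<lambda>X. (Y X - \<mu>)\<^sup>2) = E (\<lambda>X. (Y X)\<^sup>2 + \<mu>\<^sup>2 - 2 * \<mu> * Y X)"
      by (simp add: power2_eq_square algebra_simps)
    also have "\<dots> = E (\<lambda>X. (Y X)\<^sup>2) + \<mu>\<^sup>2 - 2 * \<mu> * E Y"
      unfolding E_def using int by simp
    finally show ?thesis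
      using EY int by (simp add: E_def power2_eq_square)
  qed
  also have "\<dots> \<le> N * (\<Sum>j=1..l. real (l choose j) * real (D j) * \<theta> ^ (2 * l - j)) / \<mu>\<^sup>2"
    using EY2 by (intro divide_right_mono) auto
  also have "\<dots> = (\<Sum>j=1..l. real (l choose j) * real (D j) / (\<theta> ^ j * real (card I)))"
    unfolding sum_distrib_left sum_divide_distrib
  proof (rule sum.cong)
    fix j assume "j \<in> {1..l}"
    then have "\<theta> ^ (2 * l) = \<theta> ^ (2 * l - j) * \<theta> ^ j"
      by (simp flip: power_add)
    then have "\<mu>\<^sup>2 = N\<^sup>2 * (\<theta> ^ (2 * l - j) * \<theta> ^ j)"
      by (simp add: \<mu>_def N_def power_mult_distrib power_mult[symmetric] mult.commute)
    then show "N * (real (l choose j) * real (D j) * \<theta> ^ (2 * l - j)) / \<mu>\<^sup>2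
      = real (l choose j) * real (D j) / (\<theta> ^ j * real (card I))"
      using N \<theta> by (simp add: power2_eq_square divide_simps flip: N_def)
  qed simp
  finally show ?thesis by (simp add: p_def)
qed

section \<open>Affine functionals and generic sets\<close>

text \<open>Index \<open>m\<close> holds the constant term and the smaller indices the linear
  coefficients, so a functional on \<open>m\<close>-space is a vector with \<open>m + 1\<close>
  entries.\<close>

definition (in ring) affine_eval :: "nat \<Rightarrow> (nat \<Rightarrow> 'a) \<Rightarrow> (nat \<Rightarrow> 'a) \<Rightarrow> 'a" where
  "affine_eval m a x = a m \<oplus> (\<Oplus>i\<in>{..<m}. a i \<otimes> x i)"

locale fin_field = field R for R :: "('a, 'b) ring_scheme" (structure) +
  assumes finite_carrier: "finite (carrier R)"
begin

abbreviation q :: nat where "q \<equiv> card (carrier R)"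

abbreviation vecs :: "nat \<Rightarrow> (nat \<Rightarrow> 'a) set" where
  "vecs n \<equiv> {..<n} \<rightarrow>\<^sub>E carrier R"

abbreviation affs :: "nat \<Rightarrow> (nat \<Rightarrow> 'a) set" where
  "affs m \<equiv> {..m} \<rightarrow>\<^sub>E carrier R"

text \<open>Restricted to \<open>{..m}\<close> so that it is an element of \<open>affs m\<close>:
  functionals are compared as extensional coefficient vectors, not as maps on
  \<open>vecs m\<close>.\<close>

definition aff_zero :: "nat \<Rightarrow> nat \<Rightarrow> 'a" where
  "aff_zero m = (\<lambda>i\<in>{..m}. \<zero>)"

lemma q_ge_2: "2 \<le> q"
proof -
  have "card {\<zero>, \<one>} \<le> q"
    using finite_carrier by (intro card_mono) auto
  then show ?thesis by simp
qed

lemma finite_PiE_carrier [simp]: "finite I \<Longrightarrow> finite (I \<rightarrow>\<^sub>E carrier R)"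
  using finite_carrier by (simp add: finite_PiE)

lemma card_PiE_carrier: "finite I \<Longrightarrow> card (I \<rightarrow>\<^sub>E carrier R) = q ^ card I"
  by (simp add: card_PiE)

section \<open>Affine functionals: linearity in the coefficients, and zero sets\<close>

lemma affine_eval_closed [simp]:
  "a \<in> affs m \<Longrightarrow> x \<in> vecs m \<Longrightarrow> affine_eval m a x \<in> carrier R"
  unfolding affine_eval_def by (intro a_closed finsum_closed) (auto simp: PiE_iff)

lemma affine_eval_smult:
  assumes "a \<in> affs m" and "x \<in> vecs m" and "c \<in> carrier R"
  shows "affine_eval m (\<lambda>i\<in>{..m}. c \<otimes> a i) x = c \<otimes> affine_eval m a x"
proof -
  have "(\<Oplus>i\<in>{..<m}. (\<lambda>i\<in>{..m}. c \<otimes> a i) i \<otimes> x i) = (\<Oplus>i\<in>{..<m}. c \<otimes> (a i \<otimes> x i))"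
    using assms by (intro finsum_cong') (auto simp: PiE_iff m_assoc)
  also have "\<dots> = c \<otimes> (\<Oplus>i\<in>{..<m}. a i \<otimes> x i)"
    using assms by (intro finsum_rdistr[symmetric]) (auto simp: PiE_iff)
  finally show ?thesis
    using assms unfolding affine_eval_def
    by (subst r_distr) (auto simp: PiE_iff intro!: finsum_closed)
qed

lemma affine_eval_add:
  assumes "a \<in> affs m" and "b \<in> affs m" and "x \<in> vecs m"
  shows "affine_eval m (\<lambda>i\<in>{..m}. a i \<oplus> b i) x = affine_eval m a x \<oplus> affine_eval m b x"
proof -
  have "(\<Oplus>i\<in>{..<m}. (\<lambda>i\<in>{..m}. a i \<oplus> b i) i \<otimes> x i) =
      (\<Oplus>i\<in>{..<m}. a i \<otimes> x i \<oplus> b i \<otimes> x i)"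
    using assms by (intro finsum_cong') (auto simp: PiE_iff l_distr)
  also have "\<dots> = (\<Oplus>i\<in>{..<m}. a i \<otimes> x i) \<oplus> (\<Oplus>i\<in>{..<m}. b i \<otimes> x i)"
    using assms by (intro finsum_addf) (auto simp: PiE_iff)
  finally have *: "(\<Oplus>i\<in>{..<m}. (\<lambda>i\<in>{..m}. a i \<oplus> b i) i \<otimes> x i) =
    (\<Oplus>i\<in>{..<m}. a i \<otimes> x i) \<oplus> (\<Oplus>i\<in>{..<m}. b i \<otimes> x i)" .
  have "a m \<in> carrier R" "b m \<in> carrier R"
    "(\<Oplus>i\<in>{..<m}. a i \<otimes> x i) \<in> carrier R" "(\<Oplus>i\<in>{..<m}. b i \<otimes> x i) \<in> carrier R"
    using assms by (auto simp: PiE_iff intro!: finsum_closed)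
  then show ?thesis
    unfolding affine_eval_def * by (simp add: a_ac)
qed

lemma affine_eval_remove:
  assumes "a \<in> affs m" and "x \<in> vecs m" and "i < m"
  shows "affine_eval m a x = a i \<otimes> x i \<oplus> (a m \<oplus> (\<Oplus>k\<in>{..<m} - {i}. a k \<otimes> x k))"
proof -
  have "(\<Oplus>k\<in>insert i ({..<m} - {i}). a k \<otimes> x k) =
      a i \<otimes> x i \<oplus> (\<Oplus>k\<in>{..<m} - {i}. a k \<otimes> x k)"
    using assms by (intro finsum_insert) (auto simp: PiE_iff)
  moreover have "insert i ({..<m} - {i}) = {..<m}"
    using assms by auto
  moreover have "a i \<otimes> x i \<in> carrier R" "a m \<in> carrier R"
    "(\<Oplus>k\<in>{..<m} - {i}. a k \<otimes> x k) \<in> carrier R"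
    using assms by (auto simp: PiE_iff intro!: finsum_closed)
  ultimately show ?thesis
    unfolding affine_eval_def by (metis a_lcomm)
qed

text \<open>If some linear coefficient \<open>a i\<close> is nonzero, the other \<open>m - 1\<close>
  coordinates of a zero determine \<open>x i\<close> by cancelling \<open>a i\<close>. Otherwise the
  functional is a nonzero constant and has no zeros.\<close>

lemma card_zeros_le:
  assumes a: "a \<in> affs m" "a \<noteq> aff_zero m" and "0 < m"
  shows "card {x \<in> vecs m. affine_eval m a x = \<zero>} \<le> q ^ (m - 1)"
proof (cases "\<exists>i<m. a i \<noteq> \<zero>")
  case True
  then obtain i where i: "i < m" "a i \<noteq> \<zero>" by blast
  let ?Z = "{x \<in> vecs m. affine_eval m a x = \<zero>}"
  let ?r = "\<lambda>x. restrict x ({..<m} - {i})"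
  have "card ?Z \<le> card (({..<m} - {i}) \<rightarrow>\<^sub>E carrier R)"
  proof (rule card_inj_on_le[where f = ?r])
    show "inj_on ?r ?Z"
    proof (rule inj_onI)
      fix x y assume x: "x \<in> ?Z" and y: "y \<in> ?Z" and eq: "?r x = ?r y"
      have off: "x k = y k" if "k \<noteq> i" for k
      proof (cases "k < m")
        case True
        then show ?thesis using fun_cong[OF eq, of k] that by simp
      next
        case False
        then show ?thesis using x y PiE_arb[of _ "{..<m}" _ k] by (metis (mono_tags, lifting) lessThan_iff mem_Collect_eq)
      qed
      let ?s = "\<lambda>x. a m \<oplus> (\<Oplus>k\<in>{..<m} - {i}. a k \<otimes> x k)"
      have "(\<Oplus>k\<in>{..<m} - {i}. a k \<otimes> x k) = (\<Oplus>k\<in>{..<m} - {i}. a k \<otimes> y k)"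
        using off a y by (intro finsum_cong') (auto simp: PiE_iff)
      then have s: "?s x = ?s y" by simp
      have cl: "a i \<in> carrier R" "x i \<in> carrier R" "y i \<in> carrier R" "?s y \<in> carrier R"
        using a x y i by (auto simp: PiE_iff intro!: a_closed finsum_closed)
      have "a i \<otimes> x i \<oplus> ?s x = a i \<otimes> y i \<oplus> ?s y"
        using x y affine_eval_remove[OF a(1) _ i(1), of x] affine_eval_remove[OF a(1) _ i(1), of y]
        by (metis (mono_tags, lifting) mem_Collect_eq)
      then have "a i \<otimes> x i = a i \<otimes> y i"
        unfolding s using cl by simp
      then have "x i = y i"
        using i cl by (simp add: m_lcancel)
      then have "x k = y k" for k using off[of k] by (cases "k = i") simp_all
      then show "x = y" by (rule ext)
    qed
    show "?r ` ?Z \<subseteq> ({..<m} - {i}) \<rightarrow>\<^sub>E carrier R"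
      by (intro image_subsetI) (force simp: restrict_PiE_iff)
  qed simp
  also have "\<dots> = q ^ (m - 1)"
    using i by (simp add: card_PiE_carrier)
  finally show ?thesis .
next
  case False
  have "a m \<noteq> \<zero>"
  proof
    assume "a m = \<zero>"
    then have "a i = aff_zero m i" for i
      using False PiE_arb[OF a(1), of i] by (cases i m rule: linorder_cases) (simp_all add: aff_zero_def)
    then show False using a by blast
  qed
  moreover have "affine_eval m a x = a m" if "x \<in> vecs m" for x
  proof -
    have "(\<Oplus>i\<in>{..<m}. a i \<otimes> x i) = (\<Oplus>i\<in>{..<m}. \<zero>)"
      using False that by (intro finsum_cong') (auto simp: PiE_iff)
    then show ?thesis
      using a by (auto simp: affine_eval_def PiE_iff)
  qed
  ultimately have "{x \<in> vecs m. affine_eval m a x = \<zero>} = {}" by auto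
  then show ?thesis by (simp only: card.empty)
qed

text \<open>General position: no affine hyperplane contains \<open>m + 1\<close> points of
  \<open>P\<close>. Consequently a functional is determined by its values at any
  \<open>m + 1\<close> points of \<open>P\<close>.\<close>

definition generic :: "nat \<Rightarrow> (nat \<Rightarrow> 'a) set \<Rightarrow> bool" where
  "generic m P \<longleftrightarrow>
    (\<forall>a \<in> affs m. a \<noteq> aff_zero m \<longrightarrow> card {x \<in> P. affine_eval m a x = \<zero>} \<le> m)"

definition generic_sets :: "nat \<Rightarrow> nat \<Rightarrow> (nat \<Rightarrow> 'a) set set" where
  "generic_sets m l = {P. P \<subseteq> vecs m \<and> card P = l \<and> generic m P}"

text \<open>
  Counts pairs of a non-generic set and a nonzero functional with more than \<open>m\<close> zeros in it; with
  one functional, all its \<open>q - 1\<close> nonzero multiples have this property.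
\<close>
lemma card_non_generic_le:
  assumes "0 < m" and "m < l"
  shows "(q - 1) * card {P. P \<subseteq> vecs m \<and> card P = l \<and> \<not> generic m P} \<le> q ^ (m * l)"
proof -
  let ?bad = "{P. P \<subseteq> vecs m \<and> card P = l \<and> \<not> generic m P}"
  let ?A = "affs m - {aff_zero m}"
  let ?Z = "\<lambda>a. {x \<in> vecs m. affine_eval m a x = \<zero>}"
  let ?R = "\<lambda>a P. m < card {x \<in> P. affine_eval m a x = \<zero>}"
  have fin: "finite ?bad" "finite ?A"
    by (auto intro: finite_subset[of _ "Pow (vecs m)"])
  have many: "q - 1 \<le> card {a \<in> ?A. ?R a P}" if P: "P \<in> ?bad" for P
  proof -
    obtain a where a: "a \<in> affs m" "a \<noteq> aff_zero m" "?R a P"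
      using P by (auto simp: generic_def not_le)
    obtain i where i: "i \<le> m" "a i \<noteq> \<zero>"
    proof -
      have "\<exists>i. a i \<noteq> aff_zero m i" using a by blast
      then show thesis using that a
        by (auto simp: aff_zero_def PiE_iff extensional_def split: if_splits)
    qed
    let ?f = "\<lambda>c. \<lambda>i\<in>{..m}. c \<otimes> a i"
    have "card (carrier R - {\<zero>}) \<le> card {a \<in> ?A. ?R a P}"
    proof (rule card_inj_on_le[where f = ?f])
      show "inj_on ?f (carrier R - {\<zero>})"
      proof (rule inj_onI)
        fix c d assume cd: "c \<in> carrier R - {\<zero>}" "d \<in> carrier R - {\<zero>}" and eq: "?f c = ?f d"
        have "c \<otimes> a i = d \<otimes> a i" using fun_cong[OF eq, of i] i by simp
        then show "c = d" using cd a i by (auto simp: m_rcancel PiE_iff)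
      qed
      show "?f ` (carrier R - {\<zero>}) \<subseteq> {a \<in> ?A. ?R a P}"
      proof (rule image_subsetI)
        fix c assume c: "c \<in> carrier R - {\<zero>}"
        have "?f c \<in> affs m"
          using c a by (auto simp: restrict_PiE_iff PiE_iff)
        moreover have "?f c i \<noteq> \<zero>"
          using c i a integral[of c "a i"] by (auto simp: PiE_iff)
        then have "?f c \<noteq> aff_zero m"
          using i by (metis aff_zero_def atMost_iff restrict_apply')
        moreover have "affine_eval m (?f c) x = \<zero> \<longleftrightarrow> affine_eval m a x = \<zero>" if "x \<in> P" for x
          using P c a that affine_eval_smult[of a m x c]
          by (auto simp: subset_iff integral_iff simp del: PiE_restrict)
        then have "{x \<in> P. affine_eval m (?f c) x = \<zero>} = {x \<in> P. affine_eval m a x = \<zero>}"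
          by blast
        ultimately show "?f c \<in> {a \<in> ?A. ?R a P}" using a by simp
      qed
      show "finite {a \<in> ?A. ?R a P}" using fin by simp
    qed
    then show ?thesis using finite_carrier by (simp add: card_Diff_subset)
  qed
  \<comment> \<open>A set with more than \<open>m\<close> zeros of \<open>a\<close> contains a core
    \<open>B\<close> of exactly \<open>m + 1\<close> zeros; the remaining \<open>l - (m + 1)\<close>
    points are arbitrary in \<open>vecs m\<close>.\<close>
  have few: "card {P \<in> ?bad. ?R a P} \<le> (q ^ (m - 1)) ^ (m + 1) * (q ^ m) ^ (l - (m + 1))"
    if a: "a \<in> ?A" for a
  proof -
    let ?I = "{B. B \<subseteq> ?Z a \<and> card B = m + 1}"
    have finZ: "finite (?Z a)" by simp
    have "{P \<in> ?bad. ?R a P} \<subseteq> {P. card P = l \<and> (\<exists>B\<in>?I. B \<subseteq> P \<and> P \<subseteq> vecs m)}"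
    proof (rule subsetI)
      fix P assume P: "P \<in> {P \<in> ?bad. ?R a P}"
      then have "?R a P" by blast
      then have le: "m + 1 \<le> card {x \<in> P. affine_eval m a x = \<zero>}" by linarith
      obtain B where B: "B \<subseteq> {x \<in> P. affine_eval m a x = \<zero>}" "card B = m + 1" "finite B"
        by (rule obtain_subset_with_card_n[OF le])
      have "{x \<in> P. affine_eval m a x = \<zero>} \<subseteq> ?Z a" using P by blast
      with B have "B \<in> ?I" "B \<subseteq> P" by auto
      then show "P \<in> {P. card P = l \<and> (\<exists>B\<in>?I. B \<subseteq> P \<and> P \<subseteq> vecs m)}"
        using P by blast
    qed
    moreover have "finite {P. card P = l \<and> (\<exists>B\<in>?I. B \<subseteq> P \<and> P \<subseteq> vecs m)}"
      by (rule finite_subset[of _ "Pow (vecs m)"]) auto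
    ultimately have "card {P \<in> ?bad. ?R a P} \<le>
        card {P. card P = l \<and> (\<exists>B\<in>?I. B \<subseteq> P \<and> P \<subseteq> vecs m)}"
      by (rule card_mono[rotated])
    also have "\<dots> \<le> card ?I * (q ^ m) ^ (l - (m + 1))"
      by (rule card_intermediate_sets_le)
        (auto simp: card_PiE_carrier intro: finite_subset[OF _ finZ])
    also have "card ?I \<le> (q ^ (m - 1)) ^ (m + 1)"
      using card_zeros_le a assms by (intro card_subsets_le_power finZ) auto
    finally show ?thesis by simp
  qed
  have "(q - 1) * card ?bad \<le> (\<Sum>P\<in>?bad. card {a \<in> ?A. ?R a P})"
    using sum_bounded_below[of ?bad "q - 1"] many by (simp add: mult.commute)
  also have "\<dots> = (\<Sum>P\<in>?bad. \<Sum>a\<in>{a \<in> ?A. ?R a P}. 1)" by simp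
  also have "\<dots> = (\<Sum>a\<in>?A. \<Sum>P\<in>{P \<in> ?bad. ?R a P}. 1)"
    by (rule sum.swap_restrict[OF fin])
  also have "\<dots> = (\<Sum>a\<in>?A. card {P \<in> ?bad. ?R a P})" by simp
  also have "\<dots> \<le> card ?A * ((q ^ (m - 1)) ^ (m + 1) * (q ^ m) ^ (l - (m + 1)))"
    using sum_bounded_above[of ?A, OF few] by (simp only: of_nat_id)
  also have "card ?A \<le> q ^ (m + 1)"
    using card_mono[of "affs m" ?A] by (simp add: card_PiE_carrier)
  \<comment> \<open>Each of the \<open>m + 1\<close> core points is confined to a zero set of size
    at most \<open>q ^ (m - 1)\<close> instead of \<open>q ^ m\<close>. This saves exactly what the
    choice of the functional costs, so the net gain is the factor \<open>q - 1\<close> on the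
    left.\<close>
  also have "q ^ (m + 1) * ((q ^ (m - 1)) ^ (m + 1) * (q ^ m) ^ (l - (m + 1))) = q ^ (m * l)"
  proof -
    have "(m + 1) + ((m - 1) * (m + 1) + m * (l - (m + 1))) = m * l"
    proof -
      obtain k where "m = Suc k" using assms by (cases m) auto
      moreover obtain r where "l = m + 1 + r" using assms by (auto simp: less_iff_Suc_add)
      ultimately show ?thesis by (simp add: algebra_simps)
    qed
    then show ?thesis by (metis power_add power_mult)
  qed
  finally show ?thesis by simp
qed

text \<open>There are at least \<open>(q ^ m / l) ^ l\<close> sets of \<open>l\<close> points, and
  at most \<open>q ^ (m * l) / (q - 1)\<close> of them are not generic. As
  \<open>2 * l ^ l \<le> q - 1\<close>, the latter are at most half of that lower bound.\<close>

lemma card_generic_sets_ge: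
  assumes "0 < m" and "m < l" and "2 * l ^ l < q"
  shows "real q ^ (m * l) \<le> 2 * real l ^ l * real (card (generic_sets m l))"
proof -
  let ?all = "{P. P \<subseteq> vecs m \<and> card P = l}"
  let ?bad = "{P. P \<subseteq> vecs m \<and> card P = l \<and> \<not> generic m P}"
  have fin: "finite ?all"
    by (auto intro: finite_subset[of _ "Pow (vecs m)"])
  have l: "0 < l" using assms by simp
  \<comment> \<open>The lower bound on the binomial coefficient requires
    \<open>l \<le> q ^ m\<close>, which follows from the size of \<open>q\<close>.\<close>
  have "l \<le> l ^ l" using power_increasing[of 1 l l] l by simp
  then have "l \<le> q ^ 1" using assms unfolding power_one_right by linarith
  also have "\<dots> \<le> q ^ m" using assms q_ge_2 by (intro power_increasing) auto
  finally have lq: "l \<le> q ^ m" .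
  have "(real (q ^ m) / real l) ^ l \<le> real (card ?all)"
    using binomial_ge_n_over_k_pow_k[OF lq, where 'a = real]
    by (simp add: n_subsets card_PiE_carrier)
  then have all: "real q ^ (m * l) \<le> real l ^ l * real (card ?all)"
    using l by (simp add: power_divide power_mult[symmetric] divide_simps mult.commute split: if_splits)
  have un: "?all = generic_sets m l \<union> ?bad" and disj: "generic_sets m l \<inter> ?bad = {}"
    unfolding generic_sets_def by blast+
  have "finite (generic_sets m l)" "finite ?bad"
    using fin unfolding un finite_Un by blast+
  then have split: "card ?all = card (generic_sets m l) + card ?bad"
    unfolding un using disj by (rule card_Un_disjoint)
  have "2 * l ^ l * card ?bad \<le> (q - 1) * card ?bad"
    using assms by (intro mult_right_mono) auto
  also have "\<dots> \<le> q ^ (m * l)"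
    using assms by (intro card_non_generic_le)
  finally have "real (2 * l ^ l * card ?bad) \<le> real (q ^ (m * l))"
    by (simp only: of_nat_le_iff)
  then show ?thesis
    using all unfolding split by (simp add: algebra_simps)
qed

text \<open>Extend \<open>J\<close> inside \<open>P\<close> to a set \<open>Q\<close> of at least
  \<open>m + 1\<close> points. By general position evaluation on \<open>Q\<close> is injective on
  functionals, so an interpolant of \<open>g\<close> on \<open>J\<close> is determined by its values
  on \<open>Q - J\<close>.\<close>

lemma card_interpolants_le:
  assumes P: "generic m P" "P \<subseteq> vecs m" "m < card P" and J: "J \<subseteq> P"
  shows "card {a \<in> affs m. \<forall>x\<in>J. affine_eval m a x = g x} \<le> q ^ (m + 1 - card J)"
proof -
  have fP: "finite P" using P(2) finite_subset by fastforce
  then have "card J \<le> card P" using J by (intro card_mono)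
  \<comment> \<open>The \<open>max\<close> treats two cases at once: from \<open>m + 1\<close>
    prescribed points on, \<open>Q = J\<close> and the truncated difference
    \<open>m + 1 - card J\<close> is 0.\<close>
  then obtain Q where Q: "J \<subseteq> Q" "Q \<subseteq> P" "card Q = max (card J) (m + 1)"
    using exists_subset_between[of J "max (card J) (m + 1)" P] P J fP by auto
  have fQ: "finite Q" using Q fP finite_subset by blast
  let ?S = "{a \<in> affs m. \<forall>x\<in>J. affine_eval m a x = g x}"
  let ?f = "\<lambda>a. restrict (affine_eval m a) (Q - J)"
  have "card ?S \<le> card ((Q - J) \<rightarrow>\<^sub>E carrier R)"
  proof (rule card_inj_on_le[where f = ?f])
    show "inj_on ?f ?S"
    proof (rule inj_onI)
      fix a b assume a: "a \<in> ?S" and b: "b \<in> ?S" and eq: "?f a = ?f b"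
      \<comment> \<open>The difference of \<open>a\<close> and \<open>b\<close> is written through
        scaling by \<open>\<ominus> \<one>\<close> and addition so that linearity in the
        coefficients applies. It vanishes on \<open>Q\<close>, which has more than \<open>m\<close>
        points, so it is the zero functional.\<close>
      let ?nb = "\<lambda>i\<in>{..m}. \<ominus> \<one> \<otimes> b i"
      let ?d = "\<lambda>i\<in>{..m}. a i \<oplus> ?nb i"
      have nb: "?nb \<in> affs m" using b by (auto simp: PiE_iff)
      then have d: "?d \<in> affs m" using a by (auto simp: PiE_iff)
      have "affine_eval m ?d x = \<zero>" if x: "x \<in> Q" for x
      proof -
        have xv: "x \<in> vecs m" using x Q P by blast
        have e: "affine_eval m a x = affine_eval m b x"
          using a b x fun_cong[OF eq, of x] by (cases "x \<in> J") auto
        have "affine_eval m ?d x = affine_eval m a x \<oplus> affine_eval m ?nb x"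
          using a nb xv by (intro affine_eval_add) auto
        also have "affine_eval m ?nb x = \<ominus> \<one> \<otimes> affine_eval m b x"
          using b xv by (intro affine_eval_smult) auto
        also have "affine_eval m a x \<oplus> \<ominus> \<one> \<otimes> affine_eval m b x = \<zero>"
          unfolding e using b xv by (simp add: l_minus r_neg)
        finally show ?thesis .
      qed
      then have "Q \<subseteq> {x \<in> P. affine_eval m ?d x = \<zero>}" using Q by blast
      then have "m < card {x \<in> P. affine_eval m ?d x = \<zero>}"
        using card_mono[of "{x \<in> P. affine_eval m ?d x = \<zero>}" Q] fP Q by simp
      then have d0: "?d = aff_zero m"
        using P(1) d unfolding generic_def by (meson not_le)
      have "a i = b i" if "i \<le> m" for i
      proof -
        have "a i \<oplus> \<ominus> \<one> \<otimes> b i = \<zero>"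
          using fun_cong[OF d0, of i] that by (simp add: aff_zero_def)
        moreover have "a i \<in> carrier R" "b i \<in> carrier R" using a b that by (auto simp: PiE_iff)
        ultimately show ?thesis by (metis l_minus l_one minus_equality minus_minus one_closed a_inv_closed)
      qed
      then show "a = b" using a b by (intro PiE_ext[of a "{..m}" _ b]) auto
    qed
    show "?f ` ?S \<subseteq> (Q - J) \<rightarrow>\<^sub>E carrier R"
    proof (rule image_subsetI)
      fix a assume "a \<in> ?S"
      then have "\<forall>x\<in>Q - J. affine_eval m a x \<in> carrier R"
        using Q P by (blast intro: affine_eval_closed)
      then show "?f a \<in> (Q - J) \<rightarrow>\<^sub>E carrier R" by (simp only: restrict_PiE_iff)
    qed
    show "finite ((Q - J) \<rightarrow>\<^sub>E carrier R)" using fQ by simp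
  qed
  also have "\<dots> = q ^ card (Q - J)" using fQ by (simp add: card_PiE_carrier)
  also have "card (Q - J) = m + 1 - card J"
    using Q fQ finite_subset[OF Q(1)] by (simp add: card_Diff_subset)
  finally show ?thesis .
qed

end

section \<open>Points on a common flat\<close>

context vectorspace
begin

lemma fin_dim_finite_carrier:
  assumes "finite (carrier V)"
  shows fin_dim
proof -
  have "carrier V \<subseteq> span (carrier V)"
    by (rule in_own_span) simp
  moreover have "span (carrier V) \<subseteq> carrier V"
    by (rule span_is_subset2) simp
  ultimately show ?thesis
    using assms unfolding fin_dim_def by blast
qed

lemma card_carrier_eq:
  assumes "finite (carrier V)"
  shows "card (carrier V) = card (carrier K) ^ dim"
proof -
  obtain \<beta> where \<beta>: "finite \<beta>" "basis \<beta>"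
    using finite_basis_exists[OF fin_dim_finite_carrier[OF assms]] by blast
  have sub: "\<beta> \<subseteq> carrier V" using \<beta>(2) by (simp add: basis_def)
  have uniq: "\<forall>v. v \<in> carrier V \<longrightarrow> (\<exists>!a. a \<in> \<beta> \<rightarrow>\<^sub>E carrier K \<and> lincomb a \<beta> = v)"
    using basis_criterion[OF \<beta>(1) sub] \<beta>(2) by blast
  have cl: "lincomb a \<beta> \<in> carrier V" if "a \<in> \<beta> \<rightarrow>\<^sub>E carrier K" for a
    using that sub by (intro lincomb_closed) (auto simp: PiE_def)
  have "bij_betw (\<lambda>a. lincomb a \<beta>) (\<beta> \<rightarrow>\<^sub>E carrier K) (carrier V)"
    unfolding bij_betw_def
  proof
    show "inj_on (\<lambda>a. lincomb a \<beta>) (\<beta> \<rightarrow>\<^sub>E carrier K)"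
      using uniq cl by (intro inj_onI) metis
    show "(\<lambda>a. lincomb a \<beta>) ` (\<beta> \<rightarrow>\<^sub>E carrier K) = carrier V"
    proof (intro equalityI image_subsetI subsetI)
      show "v \<in> (\<lambda>a. lincomb a \<beta>) ` (\<beta> \<rightarrow>\<^sub>E carrier K)" if "v \<in> carrier V" for v
        using uniq that by blast
    qed (rule cl)
  qed
  then have "card (carrier V) = card (\<beta> \<rightarrow>\<^sub>E carrier K)"
    by (simp add: bij_betw_same_card)
  then show ?thesis
    using \<beta> by (simp add: card_PiE dim_basis)
qed

text \<open>Vectors of the span come from coefficient functions on \<open>A\<close>. If
  \<open>A\<close> is dependent, several of these give the same vector, hence only an inequality;
  the sets \<open>A\<close> of the later count can be of this kind.\<close>

lemma card_span_le:
  assumes "finite (carrier K)" and "finite A" and "A \<subseteq> carrier V"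
  shows "finite (span A) \<and> card (span A) \<le> card (carrier K) ^ card A"
proof -
  have "span A \<subseteq> (\<lambda>a. lincomb a A) ` (A \<rightarrow>\<^sub>E carrier K)"
  proof
    fix v assume "v \<in> span A"
    then obtain a where a: "a \<in> A \<rightarrow> carrier K" "v = lincomb a A"
      using finite_span[OF assms(2,3)] by blast
    then have "v = lincomb (restrict a A) A"
      using assms(3) by (intro trans[OF a(2)] lincomb_cong) auto
    moreover have "restrict a A \<in> A \<rightarrow>\<^sub>E carrier K"
      using a(1) by (auto simp: restrict_PiE_iff)
    ultimately show "v \<in> (\<lambda>a. lincomb a A) ` (A \<rightarrow>\<^sub>E carrier K)" by blast
  qed
  moreover have fin: "finite (A \<rightarrow>\<^sub>E carrier K)"
    using assms by (simp add: finite_PiE)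
  ultimately have "finite (span A)" and "card (span A) \<le> card (A \<rightarrow>\<^sub>E carrier K)"
    using surj_card_le[OF fin] by (auto intro: finite_surj)
  then show ?thesis
    using assms(2) by (simp add: card_PiE)
qed

text \<open>The cardinality is a power of the number of scalars with the dimension as exponent, and
  having more than one scalar makes the exponent unique. A dimension can thus be established by
  counting.\<close>

lemma dim_subspace_eq_iff:
  assumes W: "subspace K W V" and fin: "finite (carrier K)" "finite (carrier V)"
  shows "vectorspace.dim K (vs W) = m \<longleftrightarrow> card W = card (carrier K) ^ m"
proof -
  interpret w: vectorspace K "vs W" by (rule subspace_is_vs[OF W])
  have "W \<subseteq> carrier V" using W by (simp add: subspace_def submodule_def)
  then have "finite (carrier (vs W))" using fin finite_subset by auto
  from w.card_carrier_eq[OF this] have "card W = card (carrier K) ^ w.dim" by simp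
  moreover have "card {\<zero>\<^bsub>K\<^esub>, \<one>\<^bsub>K\<^esub>} \<le> card (carrier K)"
    using fin by (intro card_mono) auto
  then have "1 < card (carrier K)" by simp
  ultimately show ?thesis by (simp add: power_inject_exp)
qed

text \<open>A maximal independent subset of \<open>U\<close> spans \<open>U\<close>, and it has at
  most \<open>m\<close> elements because it is independent in \<open>W\<close> as well. Padding with
  further elements of \<open>U\<close> makes the size exactly \<open>m\<close>, possibly at the loss
  of independence.\<close>

lemma exists_spanning_subset:
  assumes W: "subspace K W V" "vectorspace.dim K (vs W) = m"
    and fin: "finite (carrier V)" and U: "U \<subseteq> W" "m \<le> card U"
  obtains A where "A \<subseteq> U" and "card A = m" and "U \<subseteq> span A"
proof -
  interpret w: vectorspace K "vs W" by (rule subspace_is_vs[OF W(1)])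
  have WV: "W \<subseteq> carrier V" using W by (simp add: subspace_def submodule_def)
  have finW: "finite W" using fin WV finite_subset by blast
  have finU: "finite U" using finW U finite_subset by blast
  have UV: "U \<subseteq> carrier V" using U WV by blast
  let ?P = "\<lambda>A. A \<subseteq> U \<and> lin_indpt A"
  have "?P {}" by (simp add: lin_dep_def)
  then obtain A where A: "?P A" "\<And>A'. ?P A' \<Longrightarrow> card A' \<le> card A"
    using ex_has_greatest_nat[of ?P "{}" card "Suc (card U)"] finU
    by (metis (no_types, lifting) card_mono le_imp_less_Suc)
  have fA: "finite A" using A finU finite_subset by blast
  have "\<not> w.lin_dep A"
    using span_li_not_depend(2)[of A W] A(1) U(1) W(1) by (auto simp: subspace_def)
  then have "card A \<le> m"
    using w.li_le_dim(2)[OF w.fin_dim_finite_carrier, of A] finW A(1) U(1) W(2) by auto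
  then obtain A' where A': "A \<subseteq> A'" "A' \<subseteq> U" "card A' = m"
    using exists_subset_between[of A m U] A(1) U(2) finU by blast
  have "U \<subseteq> span A"
  proof
    fix u assume u: "u \<in> U"
    show "u \<in> span A"
    proof (cases "u \<in> A")
      case True
      then show ?thesis using in_own_span[of A] A(1) UV by blast
    next
      case False
      have "lin_dep (A \<union> {u})"
      proof (rule ccontr)
        assume "lin_indpt (A \<union> {u})"
        then have "card (A \<union> {u}) \<le> card A" using A u by (intro A(2)) blast
        then show False using False fA by simp
      qed
      then show ?thesis
        using lin_dep_iff_in_span[of A u] A(1) UV u False by blast
    qed
  qed
  also have "span A \<subseteq> span A'" using A'(1) by (rule span_is_monotone)
  finally show thesis using that A' by blast
qed

end

section \<open>Counting point sets on flats, and the first moment bound\<close>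

context fin_field
begin

lemma vectorspace_coord_space: "vectorspace R (coord_space R n)"
  unfolding vectorspace_def coord_space_def
  using func_space_is_module field_axioms by blast

lemma carrier_coord_space [simp]: "carrier (coord_space R n) = vecs n"
  by (simp add: coord_space_def func_space_def)

text \<open>Rebased at a point \<open>b\<close> of \<open>T\<close>, the flat is
  \<open>b + W\<close>, and the differences from \<open>b\<close> of the other points of
  \<open>T\<close> are at least \<open>m\<close> vectors of \<open>W\<close>. Some \<open>m\<close>
  of them span them all, so \<open>m + 1\<close> points of \<open>T\<close> determine a hull
  containing \<open>T\<close>.\<close>

lemma flat_points_spanned:
  assumes S: "is_flat R n m S" and T: "T \<subseteq> S" "m < card T"
  obtains b A where "b \<in> vecs n" and "A \<subseteq> vecs n - {\<zero>\<^bsub>coord_space R n\<^esub>}" and "card A = m"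
    and "insert b ((\<oplus>\<^bsub>coord_space R n\<^esub>) b ` A) \<subseteq> T"
    and "T \<subseteq> (\<oplus>\<^bsub>coord_space R n\<^esub>) b ` module.span R (coord_space R n) A"
proof -
  let ?V = "coord_space R n"
  interpret V: vectorspace R ?V by (rule vectorspace_coord_space)
  obtain W v where W: "VectorSpace.subspace R W ?V" "vectorspace.dim R (V.vs W) = m"
    and v: "v \<in> carrier ?V" and SW: "S = (\<lambda>w. v \<oplus>\<^bsub>?V\<^esub> w) ` W"
    using S unfolding is_flat_def by blast
  interpret W: submodule R W ?V using W by (simp add: subspace_def)
  have WV: "W \<subseteq> carrier ?V" by (rule W.subset)
  obtain b where b: "b \<in> T" using T by fastforce
  then obtain w0 where w0: "w0 \<in> W" "b = v \<oplus>\<^bsub>?V\<^esub> w0" using T SW by blast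
  have bV: "b \<in> carrier ?V" using w0 v WV by blast
  \<comment> \<open>Excluding the zero vector ensures that \<open>b\<close> and its translates by
    the elements of \<open>A\<close> are \<open>m + 1\<close> distinct points, the core of the later
    count.\<close>
  define U where "U = {u \<in> W. u \<noteq> \<zero>\<^bsub>?V\<^esub> \<and> b \<oplus>\<^bsub>?V\<^esub> u \<in> T}"
  have TU: "T \<subseteq> insert b ((\<oplus>\<^bsub>?V\<^esub>) b ` U)"
  proof
    fix t assume t: "t \<in> T"
    then obtain w where w: "w \<in> W" "t = v \<oplus>\<^bsub>?V\<^esub> w" using T SW by blast
    define u where "u = w \<ominus>\<^bsub>?V\<^esub> w0"
    have "\<ominus> \<one> \<odot>\<^bsub>?V\<^esub> w0 \<in> W" using w0 by (intro W.smult_closed) simp_all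
    then have minus: "\<ominus>\<^bsub>?V\<^esub> w0 \<in> W"
      using V.smult_minus_1[OF subsetD[OF WV w0(1)]] by simp
    have uW: "u \<in> W" unfolding u_def a_minus_def using w minus by blast
    have wV: "w \<in> carrier ?V" "w0 \<in> carrier ?V" "\<ominus>\<^bsub>?V\<^esub> w0 \<in> carrier ?V"
      using w w0 minus WV by blast+
    have "b \<oplus>\<^bsub>?V\<^esub> u = v \<oplus>\<^bsub>?V\<^esub> (w0 \<oplus>\<^bsub>?V\<^esub> (\<ominus>\<^bsub>?V\<^esub> w0 \<oplus>\<^bsub>?V\<^esub> w))"
      unfolding u_def a_minus_def w0(2) using v wV
      by (metis V.a_assoc V.a_comm V.a_closed)
    also have "\<dots> = t" using v wV w(2) by (simp add: V.r_neg2)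
    finally have tu: "b \<oplus>\<^bsub>?V\<^esub> u = t" .
    show "t \<in> insert b ((\<oplus>\<^bsub>?V\<^esub>) b ` U)"
    proof (cases "u = \<zero>\<^bsub>?V\<^esub>")
      case True
      then show ?thesis using tu bV by (metis V.r_zero insertI1)
    next
      case False
      then have "u \<in> U" using uW tu t by (simp add: U_def)
      then show ?thesis using tu by blast
    qed
  qed
  have finV: "finite (carrier ?V)" unfolding carrier_coord_space by simp
  have UW: "U \<subseteq> W" by (auto simp: U_def)
  have finU: "finite U" using finV UW WV by (meson finite_subset)
  \<comment> \<open>The successor accounts for \<open>b\<close> itself, so a set \<open>T\<close>
    with strictly more than \<open>m\<close> points leaves at least \<open>m\<close>
    differences.\<close>
  have "card T \<le> Suc (card U)"
    using card_mono[OF _ TU] card_insert_le_m1[of "Suc (card U)" "(\<oplus>\<^bsub>?V\<^esub>) b ` U" b]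
      card_image_le[OF finU, of "(\<oplus>\<^bsub>?V\<^esub>) b"] finU by simp
  then have "m \<le> card U" using T by simp
  from V.exists_spanning_subset[OF W finV UW this]
  obtain A where A: "A \<subseteq> U" "card A = m" "U \<subseteq> V.span A" by blast
  have AV: "A \<subseteq> carrier ?V" using A UW WV by blast
  show thesis
  proof (rule that[of b A])
    show "b \<in> vecs n" using bV unfolding carrier_coord_space .
    show "A \<subseteq> vecs n - {\<zero>\<^bsub>?V\<^esub>}"
      using AV A(1) unfolding carrier_coord_space U_def by blast
    show "insert b ((\<oplus>\<^bsub>?V\<^esub>) b ` A) \<subseteq> T" using A(1) b by (auto simp: U_def)
    have "\<zero>\<^bsub>?V\<^esub> \<in> V.span A"
      using V.span_is_submodule[OF AV] by (simp add: submodule_def)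
    moreover have "b = b \<oplus>\<^bsub>?V\<^esub> \<zero>\<^bsub>?V\<^esub>" using bV by simp
    ultimately show "T \<subseteq> (\<oplus>\<^bsub>?V\<^esub>) b ` V.span A" using TU A(3) by blast
  qed (rule A(2))
qed

text \<open>By \<open>flat_points_spanned\<close> every such \<open>T\<close> lies between the core
  \<open>?B (b, A)\<close> and the hull \<open>?h (b, A)\<close> for some \<open>b\<close> and
  \<open>A\<close>, so \<open>card_intermediate_sets_le\<close> applies with
  \<open>k = m + 1\<close> and \<open>D = q ^ m\<close>.\<close>

lemma card_sets_in_flats_le:
  assumes "m < n" and "m < l"
  shows "finite {T. card T = l \<and> (\<exists>S. is_flat R n m S \<and> T \<subseteq> S)}" (is "finite ?\<T>")
    and "card {T. card T = l \<and> (\<exists>S. is_flat R n m S \<and> T \<subseteq> S)} \<le> q ^ ((n - m) * (m + 1) + m * l)"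
proof -
  let ?V = "coord_space R n"
  interpret V: vectorspace R ?V by (rule vectorspace_coord_space)
  let ?As = "{A. A \<subseteq> vecs n - {\<zero>\<^bsub>?V\<^esub>} \<and> card A = m}"
  let ?I = "vecs n \<times> ?As"
  let ?B = "\<lambda>(b, A). insert b ((\<oplus>\<^bsub>?V\<^esub>) b ` A)"
  let ?h = "\<lambda>(b, A). (\<oplus>\<^bsub>?V\<^esub>) b ` V.span A"
  let ?M = "{P. card P = l \<and> (\<exists>i\<in>?I. ?B i \<subseteq> P \<and> P \<subseteq> ?h i)}"
  have sub: "?\<T> \<subseteq> ?M"
  proof (rule subsetI)
    fix T assume "T \<in> ?\<T>"
    then obtain S where T: "card T = l" and S: "is_flat R n m S" "T \<subseteq> S" by blast
    from flat_points_spanned[OF S] T assms obtain b A where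
      "b \<in> vecs n" "A \<subseteq> vecs n - {\<zero>\<^bsub>?V\<^esub>}" "card A = m"
      "insert b ((\<oplus>\<^bsub>?V\<^esub>) b ` A) \<subseteq> T" "T \<subseteq> (\<oplus>\<^bsub>?V\<^esub>) b ` V.span A"
      by metis
    then have "(b, A) \<in> ?I" "?B (b, A) \<subseteq> T" "T \<subseteq> ?h (b, A)" by simp_all
    with T show "T \<in> ?M" by blast
  qed
  have finV: "finite (vecs n)" by simp
  have finAs: "finite ?As" by (rule finite_subset[of _ "Pow (vecs n)"]) auto
  have B: "finite (?B i) \<and> card (?B i) = m + 1" if "i \<in> ?I" for i
  proof -
    obtain b A where i: "i = (b, A)" by (cases i)
    have b: "b \<in> carrier ?V" and A: "A \<subseteq> carrier ?V" "\<zero>\<^bsub>?V\<^esub> \<notin> A" "card A = m"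
      using that unfolding i carrier_coord_space by blast+
    have fA: "finite A" using A(1) finV finite_subset unfolding carrier_coord_space by blast
    have "inj_on ((\<oplus>\<^bsub>?V\<^esub>) b) A"
    proof (rule inj_onI)
      fix x y assume "x \<in> A" "y \<in> A" and eq: "b \<oplus>\<^bsub>?V\<^esub> x = b \<oplus>\<^bsub>?V\<^esub> y"
      then have x: "x \<in> carrier ?V" and y: "y \<in> carrier ?V" using A(1) by blast+
      show "x = y" using V.r_neg1[OF b x] V.r_neg1[OF b y] unfolding eq by (rule trans[OF sym])
    qed
    then have "card ((\<oplus>\<^bsub>?V\<^esub>) b ` A) = m" using A(3) card_image by blast
    moreover have "b \<notin> (\<oplus>\<^bsub>?V\<^esub>) b ` A"
    proof
      assume "b \<in> (\<oplus>\<^bsub>?V\<^esub>) b ` A"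
      then obtain a where a: "a \<in> A" "b = b \<oplus>\<^bsub>?V\<^esub> a" by blast
      then have aV: "a \<in> carrier ?V" using A(1) by blast
      have "a = \<zero>\<^bsub>?V\<^esub>"
        using V.r_neg1[OF b aV] V.l_neg[OF b] unfolding a(2)[symmetric] by (rule trans[OF sym])
      with a A(2) show False by blast
    qed
    ultimately show ?thesis using fA by (simp add: i)
  qed
  have h: "finite (?h i) \<and> card (?h i) \<le> q ^ m" if "i \<in> ?I" for i
  proof -
    obtain b A where i: "i = (b, A)" by (cases i)
    have A: "A \<subseteq> carrier ?V" "card A = m"
      using that unfolding i carrier_coord_space by blast+
    have fA: "finite A" using A(1) finV finite_subset unfolding carrier_coord_space by blast
    have s: "finite (V.span A) \<and> card (V.span A) \<le> q ^ m"
      using V.card_span_le[OF finite_carrier fA A(1)] A(2) by simp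
    then have "card ((\<oplus>\<^bsub>?V\<^esub>) b ` V.span A) \<le> q ^ m"
      using card_image_le le_trans by blast
    then show ?thesis using s by (simp add: i)
  qed
  have "?M \<subseteq> Pow (\<Union>i\<in>?I. ?h i)" by blast
  moreover have "finite (\<Union>i\<in>?I. ?h i)"
    using finV finAs h by (intro finite_UN_I finite_cartesian_product) blast+
  ultimately have finM: "finite ?M" by (meson finite_Pow_iff finite_subset)
  show "finite ?\<T>" using sub finM by (rule finite_subset)
  have "card ?\<T> \<le> card ?M" using finM sub by (rule card_mono)
  also have "\<dots> \<le> card ?I * (q ^ m) ^ (l - (m + 1))"
    using finV finAs by (intro card_intermediate_sets_le[OF _ B h] finite_cartesian_product)
  also have "card ?I \<le> q ^ n * (q ^ n) ^ m"
  proof -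
    have "card (vecs n - {\<zero>\<^bsub>?V\<^esub>}) \<le> q ^ n"
      using card_mono[OF finV Diff_subset, of "{\<zero>\<^bsub>?V\<^esub>}"] by (simp only: card_PiE_carrier finite_lessThan card_lessThan)
    then have "card ?As \<le> (q ^ n) ^ m" using finV by (intro card_subsets_le_power) blast+
    then show ?thesis by (simp add: card_cartesian_product card_PiE_carrier)
  qed
  \<comment> \<open>The exponent \<open>n * (m + 1)\<close> for the core plus
    \<open>m * (l - m - 1)\<close> for the rest regroups to the one in the theorem.\<close>
  also have "q ^ n * (q ^ n) ^ m * (q ^ m) ^ (l - (m + 1)) = q ^ ((n - m) * (m + 1) + m * l)"
  proof -
    have "n + n * m + m * (l - (m + 1)) = (n - m) * (m + 1) + m * l"
    proof -
      obtain k where "n = m + k" using assms less_imp_add_positive by blast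
      moreover obtain r where "l = m + 1 + r" using assms by (auto simp: less_iff_Suc_add)
      ultimately show ?thesis by (simp add: algebra_simps)
    qed
    then show ?thesis by (metis power_add power_mult)
  qed
  finally show "card ?\<T> \<le> q ^ ((n - m) * (m + 1) + m * l)" by simp
qed

lemma is_flat_subset: "is_flat R n m S \<Longrightarrow> S \<subseteq> vecs n"
proof -
  assume "is_flat R n m S"
  interpret V: vectorspace R "coord_space R n" by (rule vectorspace_coord_space)
  from \<open>is_flat R n m S\<close> obtain W v where "submodule R W (coord_space R n)"
    "v \<in> carrier (coord_space R n)" "S = (\<lambda>w. v \<oplus>\<^bsub>coord_space R n\<^esub> w) ` W"
    unfolding is_flat_def VectorSpace.subspace_def by blast
  then have "S \<subseteq> carrier (coord_space R n)"
    using submodule.subset V.a_closed by fast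
  then show ?thesis unfolding carrier_coord_space .
qed

text \<open>Union bound: a rich flat shares some \<open>l\<close>-set with \<open>X\<close>, and
  each of the counted \<open>l\<close>-sets lies in \<open>X\<close> with probability
  \<open>\<theta> ^ l\<close>.\<close>

lemma prob_rich_flat_le:
  assumes "m < n" and "m < l" and "0 \<le> \<theta>" and "\<theta> \<le> 1"
  shows "prob_rich_flat R n m l \<theta> \<le> real q ^ ((n - m) * (m + 1) + m * l) * \<theta> ^ l"
proof -
  let ?\<T> = "{T. card T = l \<and> (\<exists>S. is_flat R n m S \<and> T \<subseteq> S)}"
  let ?p = "random_subset (vecs n) \<theta>"
  note card_\<T> = card_sets_in_flats_le[OF assms(1,2)]
  have "{X. \<exists>S. is_flat R n m S \<and> rich l X S} \<subseteq> (\<Union>T\<in>?\<T>. {X. T \<subseteq> X})"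
  proof (rule subsetI)
    fix X assume "X \<in> {X. \<exists>S. is_flat R n m S \<and> rich l X S}"
    then obtain S where S: "is_flat R n m S" "l \<le> card (S \<inter> X)"
      unfolding rich_def by blast
    obtain T where "T \<subseteq> S \<inter> X" "card T = l" "finite T"
      by (rule obtain_subset_with_card_n[OF S(2)])
    with S show "X \<in> (\<Union>T\<in>?\<T>. {X. T \<subseteq> X})" by blast
  qed
  then have "prob_rich_flat R n m l \<theta> \<le> measure_pmf.prob ?p (\<Union>T\<in>?\<T>. {X. T \<subseteq> X})"
    unfolding prob_rich_flat_def carrier_coord_space
    by (rule measure_pmf.finite_measure_mono) simp
  also have "\<dots> \<le> (\<Sum>T\<in>?\<T>. measure_pmf.prob ?p {X. T \<subseteq> X})"
    by (rule measure_pmf.finite_measure_subadditive_finite[OF card_\<T>(1)]) simp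
  also have "\<dots> = (\<Sum>T\<in>?\<T>. \<theta> ^ l)"
  proof (rule sum.cong[OF refl])
    fix T assume "T \<in> ?\<T>"
    then have "T \<subseteq> vecs n" "card T = l" using is_flat_subset by blast+
    then show "measure_pmf.prob ?p {X. T \<subseteq> X} = \<theta> ^ l"
      using prob_random_subset_superset[of "vecs n" T \<theta>] assms(3,4) by (simp only: finite_PiE_carrier finite_lessThan)
  qed
  also have "\<dots> = real (card ?\<T>) * \<theta> ^ l" by simp
  also have "\<dots> \<le> real (q ^ ((n - m) * (m + 1) + m * l)) * \<theta> ^ l"
    using card_\<T>(2) assms(3) by (intro mult_right_mono) (simp_all only: of_nat_le_iff zero_le_power)
  finally show ?thesis by (simp only: of_nat_power)
qed

section \<open>Graphs of affine maps\<close>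

text \<open>Reaches just the flats that project bijectively onto the first \<open>m\<close>
  coordinates. Since these coordinates are kept as \<open>x\<close>, the point below is recovered by
  restriction.\<close>

definition graph_point :: "nat \<Rightarrow> nat \<Rightarrow> (nat \<Rightarrow> nat \<Rightarrow> 'a) \<Rightarrow> (nat \<Rightarrow> 'a) \<Rightarrow> nat \<Rightarrow> 'a" where
  "graph_point m n c x = (\<lambda>j\<in>{..<n}. if j < m then x j else affine_eval m (c j) x)"

abbreviation graph_coeffs :: "nat \<Rightarrow> nat \<Rightarrow> (nat \<Rightarrow> nat \<Rightarrow> 'a) set" where
  "graph_coeffs m n \<equiv> {m..<n} \<rightarrow>\<^sub>E affs m"

lemma restrict_graph_point:
  assumes "m \<le> n" and "x \<in> vecs m"
  shows "restrict (graph_point m n c x) {..<m} = x"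
proof
  fix i
  show "restrict (graph_point m n c x) {..<m} i = x i"
    using assms(1) PiE_arb[OF assms(2), of i] by (cases "i < m") (simp_all add: graph_point_def)
qed

lemma inj_on_graph_point: "m \<le> n \<Longrightarrow> P \<subseteq> vecs m \<Longrightarrow> inj_on (graph_point m n c) P"
  by (rule inj_onI) (metis restrict_graph_point subsetD)

lemma graph_point_closed:
  assumes "c \<in> graph_coeffs m n" and "x \<in> vecs m"
  shows "graph_point m n c x \<in> vecs n"
proof -
  have "\<forall>j\<in>{..<n}. (if j < m then x j else affine_eval m (c j) x) \<in> carrier R"
  proof
    fix j assume "j \<in> {..<n}"
    then show "(if j < m then x j else affine_eval m (c j) x) \<in> carrier R"
      using PiE_mem[OF assms(1), of j] PiE_mem[OF assms(2), of j] assms(2)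
      by (cases "j < m") simp_all
  qed
  then show ?thesis unfolding graph_point_def restrict_PiE_iff .
qed

text \<open>The graph is a translate of the graph of the linear part. The latter is the image of an
  injective linear map, so it has \<open>q ^ m\<close> elements and therefore dimension
  \<open>m\<close>.\<close>

lemma is_flat_graph:
  assumes "m \<le> n" and c: "c \<in> graph_coeffs m n"
  shows "is_flat R n m (graph_point m n c ` vecs m)"
proof -
  let ?U = "coord_space R m" and ?V = "coord_space R n"
  interpret U: vectorspace R ?U by (rule vectorspace_coord_space)
  interpret V: vectorspace R ?V by (rule vectorspace_coord_space)
  \<comment> \<open>Here \<open>s j\<close> is the linear part of the functional \<open>c j\<close>,
    \<open>f\<close> the graph map of these linear parts, and \<open>v\<close> the graph point over
    the origin.\<close>
  define s where "s j x = (\<Oplus>i\<in>{..<m}. c j i \<otimes> x i)" for j x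
  define f where "f x = (\<lambda>j\<in>{..<n}. if j < m then x j else s j x)" for x
  define v where "v = (\<lambda>j\<in>{..<n}. if j < m then \<zero> else c j m)"
  have cc: "c j i \<in> carrier R" if "m \<le> j" "j < n" "i \<le> m" for i j
    using PiE_mem[OF PiE_mem[OF c, of j], of i] that by simp
  have xc: "x i \<in> carrier R" if "x \<in> vecs m" "i < m" for x i
    using PiE_mem[OF that(1), of i] that by simp
  have sc: "s j x \<in> carrier R" if "m \<le> j" "j < n" "x \<in> vecs m" for j x
    unfolding s_def using that cc xc by (intro finsum_closed) simp
  have fc: "f x \<in> vecs n" if "x \<in> vecs m" for x
    unfolding f_def restrict_PiE_iff using that sc xc by simp
  have vc: "v \<in> vecs n"
    unfolding v_def restrict_PiE_iff using cc by simp
  have s_add: "s j (\<lambda>i\<in>{..<m}. x i \<oplus> y i) = s j x \<oplus> s j y"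
    if j: "m \<le> j" "j < n" and x: "x \<in> vecs m" and y: "y \<in> vecs m" for j x y
  proof -
    have "s j (\<lambda>i\<in>{..<m}. x i \<oplus> y i) = (\<Oplus>i\<in>{..<m}. c j i \<otimes> x i \<oplus> c j i \<otimes> y i)"
      unfolding s_def using j cc xc[OF x] xc[OF y] by (intro finsum_cong') (simp_all add: r_distr)
    also have "\<dots> = s j x \<oplus> s j y"
      unfolding s_def using j cc xc[OF x] xc[OF y] by (intro finsum_addf) simp_all
    finally show ?thesis .
  qed
  have s_smult: "s j (\<lambda>i\<in>{..<m}. r \<otimes> x i) = r \<otimes> s j x"
    if j: "m \<le> j" "j < n" and r: "r \<in> carrier R" and x: "x \<in> vecs m" for j r x
  proof -
    have "s j (\<lambda>i\<in>{..<m}. r \<otimes> x i) = (\<Oplus>i\<in>{..<m}. r \<otimes> (c j i \<otimes> x i))"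
      unfolding s_def using j cc xc[OF x] r by (intro finsum_cong') (simp_all add: m_lcomm)
    also have "\<dots> = r \<otimes> s j x"
      unfolding s_def using j cc xc[OF x] r by (intro finsum_rdistr[symmetric]) simp_all
    finally show ?thesis .
  qed
  have f_add: "f (x \<oplus>\<^bsub>?U\<^esub> y) = f x \<oplus>\<^bsub>?V\<^esub> f y" if "x \<in> vecs m" "y \<in> vecs m" for x y
  proof
    fix j
    show "f (x \<oplus>\<^bsub>?U\<^esub> y) j = (f x \<oplus>\<^bsub>?V\<^esub> f y) j"
      using that s_add[of j x y]
      by (cases "j < n"; cases "j < m") (simp_all add: f_def coord_space_def func_space_def)
  qed
  have f_smult: "f (r \<odot>\<^bsub>?U\<^esub> x) = r \<odot>\<^bsub>?V\<^esub> f x" if "r \<in> carrier R" "x \<in> vecs m" for r x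
  proof
    fix j
    show "f (r \<odot>\<^bsub>?U\<^esub> x) j = (r \<odot>\<^bsub>?V\<^esub> f x) j"
      using that s_smult[of j r x]
      by (cases "j < n"; cases "j < m") (simp_all add: f_def coord_space_def func_space_def)
  qed
  have hom: "f \<in> module_hom R ?U ?V"
    unfolding module_hom_def carrier_coord_space
    by (intro CollectI conjI Pi_I allI impI ballI; (elim conjE)?; rule fc f_add f_smult; assumption)
  interpret f: linear_map R ?U ?V f
    by unfold_locales (rule hom)
  have W: "VectorSpace.subspace R (f ` vecs m) ?V"
    using f.imT_is_subspace unfolding f.im_def carrier_coord_space .
  have "inj_on f (vecs m)"
  proof (rule inj_onI)
    fix x y assume x: "x \<in> vecs m" and y: "y \<in> vecs m" and eq: "f x = f y"
    show "x = y"
    proof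
      fix i
      show "x i = y i"
        using fun_cong[OF eq, of i] PiE_arb[OF x, of i] PiE_arb[OF y, of i] assms(1)
        by (cases "i < m") (simp_all add: f_def)
    qed
  qed
  then have "card (f ` vecs m) = q ^ m"
    by (simp only: card_image card_PiE_carrier finite_lessThan card_lessThan)
  then have dim: "vectorspace.dim R (?V\<lparr>carrier := f ` vecs m\<rparr>) = m"
    by (subst V.dim_subspace_eq_iff[OF W]) (simp_all only: finite_carrier carrier_coord_space finite_PiE_carrier finite_lessThan)
  have "graph_point m n c x = v \<oplus>\<^bsub>?V\<^esub> f x" if x: "x \<in> vecs m" for x
  proof
    fix j
    show "graph_point m n c x j = (v \<oplus>\<^bsub>?V\<^esub> f x) j"
      using xc[OF x, of j]
      by (cases "j < n"; cases "j < m")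
        (simp_all add: graph_point_def affine_eval_def s_def v_def f_def coord_space_def func_space_def)
  qed
  then have "graph_point m n c ` vecs m = (\<lambda>w. v \<oplus>\<^bsub>?V\<^esub> w) ` f ` vecs m"
    by (simp only: image_image cong: image_cong)
  then show ?thesis
    unfolding is_flat_def carrier_coord_space using W dim vc by blast
qed

text \<open>Projection to the first \<open>m\<close> coordinates turns \<open>J\<close> into a set
  of \<open>card J\<close> points contained in every \<open>P\<close> that occurs, and the values of
  each \<open>c j\<close> on it are the \<open>j\<close>-th coordinates of the points of
  \<open>J\<close>. The choices of \<open>P\<close> and of the \<open>n - m\<close> functionals are
  then bounded separately.\<close>

lemma card_graphs_containing_le:
  assumes "m < n" and "m < l"
  shows "card {i \<in> generic_sets m l \<times> graph_coeffs m n. J \<subseteq> graph_point m n (snd i) ` fst i}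
    \<le> q ^ (m * (l - card J) + (m + 1 - card J) * (n - m))" (is "card ?K \<le> _")
proof (cases "?K = {}")
  case True
  then show ?thesis by (simp only: card.empty le0)
next
  case False
  \<comment> \<open>A reference pair: \<open>P0\<close> is a generic superset of the projected
    \<open>J\<close>, as the interpolation bound requires, and \<open>c0\<close> supplies the
    prescribed values, with which all other pairs agree.\<close>
  then obtain i0 where i0: "i0 \<in> ?K" unfolding ex_in_conv[symmetric] by (rule exE)
  obtain P0 c0 where "i0 = (P0, c0)" by (cases i0)
  then have K0: "(P0, c0) \<in> ?K" using i0 by (simp only:)
  let ?r = "\<lambda>y. restrict y {..<m}"
  let ?G = "\<lambda>j. {a \<in> affs m. \<forall>x\<in>?r ` J. affine_eval m a x = affine_eval m (c0 j) x}"
  have *: "y = graph_point m n c (?r y) \<and> ?r y \<in> P" if K: "(P, c) \<in> ?K" and y: "y \<in> J" for P c y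
  proof -
    have P: "P \<subseteq> vecs m" and J: "J \<subseteq> graph_point m n c ` P"
      using K unfolding generic_sets_def by auto
    then obtain x where x: "x \<in> P" "y = graph_point m n c x" using y by blast
    have "?r y = x" unfolding x(2) using x(1) P assms(1) by (intro restrict_graph_point) auto
    then show ?thesis using x by simp
  qed
  have eval: "affine_eval m (c j) (?r y) = y j" if "(P, c) \<in> ?K" "y \<in> J" "j \<in> {m..<n}" for P c y j
  proof -
    have "graph_point m n c (?r y) j = affine_eval m (c j) (?r y)"
      using that(3) by (simp add: graph_point_def)
    then show ?thesis using *[OF that(1,2)] by simp
  qed
  have "inj_on ?r J" using *[OF K0] by (intro inj_onI) metis
  then have cJ: "card (?r ` J) = card J" by (rule card_image)
  have P0: "generic m P0" "P0 \<subseteq> vecs m" "m < card P0" "?r ` J \<subseteq> P0"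
    using K0 *[OF K0] assms unfolding generic_sets_def by auto
  have fr: "finite (?r ` J)"
    by (rule finite_subset[OF P0(4) finite_subset[OF P0(2)]]) simp
  \<comment> \<open>The index set is a singleton because there is one core, the projected
    \<open>J\<close>, and one hull, the whole \<open>m\<close>-space.\<close>
  let ?E = "{P. card P = l \<and> (\<exists>i\<in>{()}. ?r ` J \<subseteq> P \<and> P \<subseteq> vecs m)}"
  have finE: "finite ?E" by (rule finite_subset[of _ "Pow (vecs m)"]) auto
  have finG: "finite (?G j)" for j by simp
  have "?K \<subseteq> ?E \<times> (\<Pi>\<^sub>E j\<in>{m..<n}. ?G j)"
  proof (rule subsetI)
    fix i assume i: "i \<in> ?K"
    obtain P c where ic: "i = (P, c)" by (cases i)
    have K: "(P, c) \<in> ?K" using i unfolding ic .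
    have "P \<in> ?E" using K *[OF K] unfolding generic_sets_def by auto
    moreover have cC: "c \<in> graph_coeffs m n" using K by blast
    have "c \<in> (\<Pi>\<^sub>E j\<in>{m..<n}. ?G j)"
    proof (rule PiE_I)
      fix j assume j: "j \<in> {m..<n}"
      have "\<forall>x\<in>?r ` J. affine_eval m (c j) x = affine_eval m (c0 j) x"
        using eval[OF K _ j] eval[OF K0 _ j] by simp
      then show "c j \<in> ?G j" using PiE_mem[OF cC j] by blast
    next
      show "c j = undefined" if "j \<notin> {m..<n}" for j using PiE_arb[OF cC that] .
    qed
    ultimately show "i \<in> ?E \<times> (\<Pi>\<^sub>E j\<in>{m..<n}. ?G j)" unfolding ic by blast
  qed
  then have "card ?K \<le> card (?E \<times> (\<Pi>\<^sub>E j\<in>{m..<n}. ?G j))"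
    using finE finG by (intro card_mono finite_cartesian_product finite_PiE) simp_all
  also have "\<dots> = card ?E * (\<Prod>j\<in>{m..<n}. card (?G j))"
    by (simp only: card_cartesian_product card_PiE finite_atLeastLessThan)
  also have "\<dots> \<le> (q ^ m) ^ (l - card J) * (q ^ (m + 1 - card J)) ^ (n - m)"
  proof (rule mult_mono)
    have "card ?E \<le> card {()} * (q ^ m) ^ (l - card J)"
      using fr cJ by (intro card_intermediate_sets_le)
        (simp_all only: finite.intros card_PiE_carrier finite_PiE_carrier finite_lessThan
          card_lessThan conj_absorb order_refl simp_thms)
    then show "card ?E \<le> (q ^ m) ^ (l - card J)" by simp
    have "(\<Prod>j\<in>{m..<n}. card (?G j)) \<le> (\<Prod>j\<in>{m..<n}. q ^ (m + 1 - card J))"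
    proof (intro prod_mono conjI le0)
      fix j
      show "card (?G j) \<le> q ^ (m + 1 - card J)"
        by (rule card_interpolants_le[OF P0(1-4), where g = "affine_eval m (c0 j)", unfolded cJ])
    qed
    then show "(\<Prod>j\<in>{m..<n}. card (?G j)) \<le> (q ^ (m + 1 - card J)) ^ (n - m)"
      by (simp only: prod_constant card_atLeastLessThan)
  qed simp_all
  also have "\<dots> = q ^ (m * (l - card J) + (m + 1 - card J) * (n - m))"
    by (simp only: power_add power_mult)
  finally show ?thesis .
qed

text \<open>If \<open>X\<close> contains the graph points over some generic \<open>P\<close>, the
  whole graph is a rich flat. Hence \<open>second_moment_bound\<close> applies to the pairs
  \<open>(P, c)\<close>, with \<open>D j\<close> supplied by
  \<open>card_graphs_containing_le\<close>.\<close>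

lemma prob_rich_flat_second_moment:
  assumes "m < n" and "m < l" and "0 < \<theta>" and "\<theta> \<le> 1" and ne: "generic_sets m l \<noteq> {}"
  shows "1 - prob_rich_flat R n m l \<theta> \<le>
    (\<Sum>j=1..l. real (l choose j) * real (q ^ (m * (l - j) + (m + 1 - j) * (n - m))) /
      (\<theta> ^ j * real (card (generic_sets m l) * q ^ ((m + 1) * (n - m)))))"
proof -
  let ?I = "generic_sets m l \<times> graph_coeffs m n"
  let ?T = "\<lambda>i. graph_point m n (snd i) ` fst i"
  let ?p = "random_subset (vecs n) \<theta>"
  have finG: "finite (generic_sets m l)"
    unfolding generic_sets_def by (rule finite_subset[of _ "Pow (vecs m)"]) auto
  have finC: "finite (graph_coeffs m n)"
    by (intro finite_PiE finite_atLeastLessThan finite_atMost finite_carrier)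
  have card_C: "card (graph_coeffs m n) = q ^ ((m + 1) * (n - m))"
    by (simp only: card_PiE finite_atLeastLessThan prod_constant card_PiE_carrier finite_atMost
        card_atMost card_atLeastLessThan power_mult Suc_eq_plus1)
  have "card (graph_coeffs m n) > 0" unfolding card_C using q_ge_2 by simp
  then have I: "finite ?I" "?I \<noteq> {}" using finG finC ne by auto
  have card_I: "card ?I = card (generic_sets m l) * q ^ ((m + 1) * (n - m))"
    by (simp only: card_cartesian_product card_C)
  have "measure_pmf.prob ?p {X. \<exists>i\<in>?I. ?T i \<subseteq> X} \<le> prob_rich_flat R n m l \<theta>"
    unfolding prob_rich_flat_def carrier_coord_space
  proof (rule measure_pmf.finite_measure_mono)
    show "{X. \<exists>i\<in>?I. ?T i \<subseteq> X} \<subseteq> {X. \<exists>S. is_flat R n m S \<and> rich l X S}"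
    proof (rule subsetI)
      fix X assume "X \<in> {X. \<exists>i\<in>?I. ?T i \<subseteq> X}"
      then obtain i where i: "i \<in> ?I" "?T i \<subseteq> X" by blast
      obtain P c where Pc: "i = (P, c)" by (cases i)
      have P: "P \<in> generic_sets m l" and c: "c \<in> graph_coeffs m n"
        and X: "graph_point m n c ` P \<subseteq> X" using i unfolding Pc by simp_all
      have Pm: "P \<subseteq> vecs m" "card P = l" using P unfolding generic_sets_def by blast+
      let ?S = "graph_point m n c ` vecs m"
      have "l = card (graph_point m n c ` P)"
        using card_image[OF inj_on_graph_point[of m n P c]] Pm assms(1) by simp
      also have "\<dots> \<le> card (?S \<inter> X)"
      proof (rule card_mono)
        have "finite ?S" by (intro finite_imageI finite_PiE_carrier finite_lessThan)
        then show "finite (?S \<inter> X)" by simp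
        show "graph_point m n c ` P \<subseteq> ?S \<inter> X" using Pm(1) X by blast
      qed
      finally have "rich l X ?S" by (simp add: rich_def)
      then show "X \<in> {X. \<exists>S. is_flat R n m S \<and> rich l X S}"
        using is_flat_graph[of m n c] c assms(1) by auto
    qed
  qed simp
  then have "1 - prob_rich_flat R n m l \<theta> \<le> 1 - measure_pmf.prob ?p {X. \<exists>i\<in>?I. ?T i \<subseteq> X}"
    by simp
  also have "\<dots> \<le> (\<Sum>j=1..l. real (l choose j) * real (q ^ (m * (l - j) + (m + 1 - j) * (n - m))) /
      (\<theta> ^ j * real (card ?I)))"
  proof (rule second_moment_bound[OF _ I])
    fix i assume i: "i \<in> ?I"
    have P: "fst i \<subseteq> vecs m" "card (fst i) = l" and c: "snd i \<in> graph_coeffs m n"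
      using i unfolding mem_Times_iff generic_sets_def mem_Collect_eq by blast+
    show "?T i \<subseteq> vecs n" using graph_point_closed[OF c] P(1) by (intro image_subsetI) blast
    show "card (?T i) = l"
      using card_image[OF inj_on_graph_point[of m n "fst i" "snd i"]] P assms(1) by simp
  next
    fix J
    show "card {i \<in> ?I. J \<subseteq> ?T i} \<le> q ^ (m * (l - card J) + (m + 1 - card J) * (n - m))"
      using assms by (intro card_graphs_containing_le)
  qed (use assms in simp_all)
  finally show ?thesis unfolding card_I .
qed

text \<open>
  The exponents match because \<open>j * (m + 1) \<le> l * min j (m + 1)\<close> for \<open>j \<le> l\<close>: no part of an
  \<open>l\<close>-set of points on a common flat is rarer than the whole.
\<close>
lemma prob_rich_flat_ge:
  fixes \<theta> s :: real
  assumes "0 < m" and "m < n" and "m < l" and "2 * l ^ l < q" and "\<theta> \<le> 1" and s: "1 \<le> s"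
    and \<theta>: "s * (real q ^ ((n - m) * (m + 1) + m * l)) powr (- 1 / real l) \<le> \<theta>"
  shows "1 - 2 ^ (l + 1) * real l ^ l / s \<le> prob_rich_flat R n m l \<theta>"
proof -
  define N where "N = (n - m) * (m + 1) + m * l"
  define t where "t = (real q ^ N) powr (- 1 / real l)"
  define g where "g = real (card (generic_sets m l))"
  define C where "C = real q ^ ((m + 1) * (n - m))"
  have q: "real q > 1" using q_ge_2 by simp
  have l: "real l > 0" using assms by simp
  have t: "t > 0" using q by (simp add: t_def)
  have \<theta>t: "s * t \<le> \<theta>" using \<theta> by (simp add: t_def N_def)
  have "0 < s * t" using s t by (intro mult_pos_pos) simp_all
  then have \<theta>0: "\<theta> > 0" using \<theta>t by linarith
  have t_eq: "t = real q powr (- real N / real l)"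
  proof -
    have "t = (real q powr real N) powr (- 1 / real l)"
      unfolding t_def by (subst powr_realpow) (use q in simp_all)
    then show ?thesis by (simp only: powr_powr times_divide_eq_right mult_minus1_right)
  qed
  have g: "real q ^ (m * l) \<le> 2 * real l ^ l * g"
    unfolding g_def using assms by (intro card_generic_sets_ge)
  have pos: "real q ^ (m * l) > 0" using q by simp
  have "g \<noteq> 0"
  proof
    assume "g = 0"
    with g have "real q ^ (m * l) \<le> 0" by simp
    with pos show False by linarith
  qed
  then have ne: "generic_sets m l \<noteq> {}" and g0: "g > 0" by (auto simp: g_def)
  have C0: "C > 0" using q by (simp add: C_def)
  \<comment> \<open>The number \<open>g * C\<close> of pairs matches, up to the factor
    \<open>2 * l ^ l\<close>, the count \<open>q ^ N\<close> of the first moment bound; this is why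
    both bounds lead to the same threshold.\<close>
  have NC: "real q ^ N \<le> 2 * real l ^ l * (g * C)"
  proof -
    have "real q ^ N = real q ^ (m * l) * C" by (simp add: N_def C_def power_add mult.commute)
    also have "\<dots> \<le> (2 * real l ^ l * g) * C" using g C0 by (intro mult_right_mono) auto
    finally show ?thesis by (simp add: mult.assoc)
  qed
  have summand: "real (q ^ (m * (l - j) + (m + 1 - j) * (n - m))) /
      (\<theta> ^ j * real (card (generic_sets m l) * q ^ ((m + 1) * (n - m)))) \<le> 2 * real l ^ l / s"
    if j: "j \<in> {1..l}" for j
  proof -
    define e where "e = m * (l - j) + (m + 1 - j) * (n - m)"
    \<comment> \<open>The inequality \<open>e \<le> N - j * N / l\<close>, multiplied by
      \<open>l\<close> to stay in the natural numbers. As \<open>t\<close> is \<open>q\<close> to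
      the power \<open>- N / l\<close>, it says that
      \<open>q ^ e \<le> t ^ j * q ^ N\<close>.\<close>
    have "l * e + N * j \<le> l * N"
    proof -
      define k where "k = n - m"
      obtain i where i: "l = j + i" using j le_Suc_ex by (metis atLeastAtMost_iff)
      \<comment> \<open>Up to \<open>j = m + 1\<close> the reason is \<open>m + 1 \<le> l\<close>;
        beyond that the truncated difference vanishes and \<open>j \<le> l\<close> suffices.\<close>
      have "l * (m + 1 - j) + (m + 1) * j \<le> l * (m + 1)"
      proof (cases "j \<le> m + 1")
        case True
        have "(m + 1) * j \<le> l * j" using assms by (intro mult_right_mono) auto
        moreover have "l * (m + 1 - j) + l * j = l * (m + 1)"
          using True by (simp only: add_mult_distrib2[symmetric] le_add_diff_inverse2)
        ultimately show ?thesis by linarith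
      next
        case False
        then have "m + 1 - j = 0" by simp
        moreover have "(m + 1) * j \<le> (m + 1) * l" using j by (intro mult_left_mono) auto
        ultimately show ?thesis by (simp only: mult_0_right add_0 mult.commute)
      qed
      then have "(l * (m + 1 - j) + (m + 1) * j) * k \<le> l * (m + 1) * k"
        by (rule mult_right_mono) simp
      moreover have "l * e + N * j = l * m * l + (l * (m + 1 - j) + (m + 1) * j) * k"
        unfolding e_def N_def k_def[symmetric] using i by (simp add: algebra_simps)
      moreover have "l * N = l * m * l + l * (m + 1) * k"
        unfolding N_def k_def[symmetric] by (simp add: algebra_simps)
      ultimately show ?thesis by linarith
    qed
    then have "real l * real e + real N * real j \<le> real l * real N"
      by (metis of_nat_add of_nat_le_iff of_nat_mult)
    then have exps: "real e \<le> - real N / real l * real j + real N"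
      using l by (simp add: field_simps)
    have "real q ^ e = real q powr real e" using q by (simp add: powr_realpow)
    also have "\<dots> \<le> real q powr (- real N / real l * real j + real N)"
      using exps q by (intro powr_mono) auto
    also have "\<dots> = t ^ j * real q ^ N"
    proof -
      have "t ^ j = real q powr (real j * (- real N / real l))"
        unfolding t_eq using q by (intro powr_power) simp
      moreover have "real q powr real N = real q ^ N"
        using q by (intro powr_realpow) simp
      ultimately show ?thesis by (simp only: powr_add mult.commute)
    qed
    finally have e: "real q ^ e \<le> t ^ j * real q ^ N" .
    \<comment> \<open>As \<open>j \<ge> 1\<close> and \<open>s \<ge> 1\<close>, every summand
      retains at least one factor \<open>s\<close>.\<close>
    have "s * t ^ j \<le> s ^ j * t ^ j"
      using s j t power_increasing[of 1 j s] by (intro mult_right_mono) auto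
    also have "\<dots> = (s * t) ^ j" by (simp add: power_mult_distrib)
    also have "\<dots> \<le> \<theta> ^ j" using \<theta>t s t by (intro power_mono) auto
    finally have st: "s * t ^ j \<le> \<theta> ^ j" .
    have "s * real q ^ e \<le> s * (t ^ j * real q ^ N)" using e s by simp
    also have "\<dots> \<le> s * (t ^ j * (2 * real l ^ l * (g * C)))"
      using NC s t by (intro mult_left_mono) auto
    also have "\<dots> = (s * t ^ j) * (2 * real l ^ l * (g * C))" by simp
    also have "\<dots> \<le> \<theta> ^ j * (2 * real l ^ l * (g * C))"
      using st g0 C0 by (intro mult_right_mono) auto
    finally have main: "s * real q ^ e \<le> \<theta> ^ j * (2 * real l ^ l * (g * C))" .
    have "real q ^ e / (\<theta> ^ j * (g * C)) \<le> 2 * real l ^ l / s"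
      using main \<theta>0 g0 C0 s by (simp add: field_simps)
    then show ?thesis by (simp add: e_def g_def C_def)
  qed
  have "1 - prob_rich_flat R n m l \<theta> \<le> (\<Sum>j=1..l. real (l choose j) *
      (real (q ^ (m * (l - j) + (m + 1 - j) * (n - m))) /
      (\<theta> ^ j * real (card (generic_sets m l) * q ^ ((m + 1) * (n - m))))))"
    using prob_rich_flat_second_moment[OF assms(2,3) \<theta>0 assms(5) ne] by (simp only: times_divide_eq_right)
  also have "\<dots> \<le> (\<Sum>j=1..l. real (l choose j) * (2 * real l ^ l / s))"
    using summand by (intro sum_mono mult_left_mono) auto
  also have "\<dots> = real (\<Sum>j=1..l. l choose j) * (2 * real l ^ l / s)"
    by (simp only: sum_distrib_right of_nat_sum)
  also have "\<dots> \<le> real (2 ^ l) * (2 * real l ^ l / s)"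
  proof (intro mult_right_mono)
    have "(\<Sum>j=1..l. l choose j) \<le> (\<Sum>j\<le>l. l choose j)" by (intro sum_mono2) auto
    then show "real (\<Sum>j=1..l. l choose j) \<le> real (2 ^ l)"
      by (simp only: choose_row_sum of_nat_le_iff)
  qed (use s in simp)
  finally show ?thesis by simp
qed

end

section \<open>The threshold\<close>

lemma power_powr_neg_inverse:
  fixes x :: real
  assumes "0 < x" and "0 < l"
  shows "(x powr (- 1 / real l)) ^ l = inverse x"
proof -
  have "(x powr (- 1 / real l)) ^ l = x powr (real l * (- 1 / real l))"
    using assms by (intro powr_power) simp
  also have "\<dots> = inverse x"
    using assms by (simp add: powr_minus)
  finally show ?thesis .
qed

theorem theorem1p6:
  fixes F :: "nat \<Rightarrow> ('a, 'b) ring_scheme"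
    and q n m l :: "nat \<Rightarrow> nat"
    and M L :: nat
  assumes "\<And>k. primepow (q k)"
    and "\<And>k. Ring.field (F k)"
    and "\<And>k. finite (carrier (F k))"
    and "\<And>k. card (carrier (F k)) = q k"
    and "filterlim q at_top sequentially"
    and "\<And>k. 3 \<le> n k"
    and "\<And>k. 0 < m k" and "\<And>k. m k \<le> M" and "\<And>k. m k < n k"
    and "\<And>k. 0 < l k" and "\<And>k. l k \<le> L" and "\<And>k. m k < l k"
  shows "threshold_function
           (\<lambda>k. prob_rich_flat (F k) (n k) (m k) (l k))
           (\<lambda>k. (real (q k) ^ ((n k - m k) * (m k + 1) + m k * l k)) powr (- 1 / real (l k)))"
proof -
  define N where "N k = (n k - m k) * (m k + 1) + m k * l k" for k
  define t where "t k = (real (q k) ^ N k) powr (- 1 / real (l k))" for k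
  let ?Pr = "\<lambda>k. prob_rich_flat (F k) (n k) (m k) (l k)"
  have field: "fin_field (F k)" for k
    using assms(2,3) by (simp add: fin_field_def fin_field_axioms_def)
  have q_pos: "0 < q k" for k using primepow_gt_Suc_0[OF assms(1)[of k]] by simp
  have t_pos: "0 < t k" for k using q_pos by (simp add: t_def)
  \<comment> \<open>At probability \<open>t\<close> the first moment bound equals 1.\<close>
  have t_power: "real (q k) ^ N k * t k ^ l k = 1" for k
    unfolding t_def using power_powr_neg_inverse[of "real (q k) ^ N k" "l k"] q_pos[of k] assms(10)[of k]
    by simp
  have zero: "(\<lambda>k. ?Pr k (\<theta> k)) \<longlonglongrightarrow> 0"
    if \<theta>: "\<And>k. 0 \<le> \<theta> k" "\<And>k. \<theta> k \<le> 1" and small: "\<theta> \<in> o(t)" for \<theta>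
  proof -
    have le: "?Pr k (\<theta> k) \<le> (\<theta> k / t k) ^ l k" for k
    proof -
      have "?Pr k (\<theta> k) \<le> real (q k) ^ N k * \<theta> k ^ l k"
        using fin_field.prob_rich_flat_le[OF field assms(9)[of k] assms(12)[of k] \<theta>(1)[of k] \<theta>(2)[of k], of k]
        by (simp only: assms(4) N_def)
      also have "\<dots> = (\<theta> k / t k) ^ l k"
        using t_power[of k] t_pos[of k] by (simp add: power_divide field_simps)
      finally show ?thesis .
    qed
    have lim: "(\<lambda>k. \<theta> k / t k) \<longlonglongrightarrow> 0"
      using small by (rule smalloD_tendsto)
    have "\<forall>\<^sub>F k in sequentially. \<theta> k / t k < 1"
      using lim by (rule order_tendstoD) simp
    then have "\<forall>\<^sub>F k in sequentially. ?Pr k (\<theta> k) \<le> \<theta> k / t k"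
    proof eventually_elim
      case (elim k)
      \<comment> \<open>Once the ratio is below 1, its power with exponent
        \<open>l k \<ge> 1\<close> is at most the ratio itself, so the varying exponent no longer
        matters.\<close>
      have "(\<theta> k / t k) ^ l k \<le> (\<theta> k / t k) ^ 1"
        using elim \<theta>(1)[of k] t_pos[of k] assms(10)[of k]
        by (intro power_decreasing) simp_all
      then show ?case using le[of k] by simp
    qed
    moreover have "\<forall>\<^sub>F k in sequentially. 0 \<le> ?Pr k (\<theta> k)"
      by (simp add: prob_rich_flat_def)
    ultimately show ?thesis
      by (intro tendsto_sandwich[OF _ _ tendsto_const lim])
  qed
  have one: "(\<lambda>k. ?Pr k (\<theta> k)) \<longlonglongrightarrow> 1"
    if \<theta>: "\<And>k. 0 \<le> \<theta> k" "\<And>k. \<theta> k \<le> 1" and large: "\<theta> \<in> \<omega>(t)" for \<theta>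
  proof (rule tendstoI)
    fix \<epsilon> :: real assume \<epsilon>: "0 < \<epsilon>"
    \<comment> \<open>A constant uniform in \<open>k\<close>, available because
      \<open>l k \<le> L\<close>. In \<open>s\<close>, the factor 2 makes \<open>C / s\<close> at
      most half of \<open>\<epsilon>\<close>, and the maximum secures
      \<open>1 \<le> s\<close>.\<close>
    define C where "C = 2 ^ (L + 1) * real L ^ L"
    define s where "s = max 1 (2 * C / \<epsilon>)"
    have s: "1 \<le> s" "C / s < \<epsilon>"
    proof -
      show "1 \<le> s" by (simp add: s_def)
      have "0 \<le> C" by (simp add: C_def)
      moreover have "2 * C / \<epsilon> \<le> s" by (simp add: s_def)
      ultimately show "C / s < \<epsilon>"
        using \<open>1 \<le> s\<close> \<epsilon> by (cases "C = 0") (simp_all add: field_simps)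
    qed
    have C: "2 ^ (l k + 1) * real (l k) ^ l k \<le> C" for k
    proof -
      have "real (l k) ^ l k \<le> real L ^ l k"
        using assms(11)[of k] by (intro power_mono) simp_all
      also have "\<dots> \<le> real L ^ L"
        using assms(10,11)[of k] by (intro power_increasing) simp_all
      finally show ?thesis
        unfolding C_def using assms(11)[of k] by (intro mult_mono power_increasing) simp_all
    qed
    have "\<forall>\<^sub>F k in sequentially. s * norm (t k) \<le> norm (\<theta> k)"
      using large s by (intro landau_omega.smallD) simp_all
    \<comment> \<open>The growth of \<open>q\<close> makes generic sets abundant; the bound with
      \<open>L\<close> covers every \<open>l k\<close> at once.\<close>
    moreover have "\<forall>\<^sub>F k in sequentially. 2 * L ^ L < q k"
      using assms(5) by (simp add: filterlim_at_top Suc_le_eq[symmetric])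
    ultimately show "\<forall>\<^sub>F k in sequentially. dist (?Pr k (\<theta> k)) 1 < \<epsilon>"
    proof eventually_elim
      case (elim k)
      have "l k ^ l k \<le> L ^ L"
        using assms(10,11)[of k]
        by (intro order_trans[OF power_mono power_increasing]) simp_all
      then have "2 * l k ^ l k < card (carrier (F k))" using elim assms(4) by simp
      moreover have "s * (real (card (carrier (F k))) ^ ((n k - m k) * (m k + 1) + m k * l k))
          powr (- 1 / real (l k)) \<le> \<theta> k"
        using elim \<theta>(1)[of k] t_pos[of k] unfolding assms(4) t_def N_def by simp
      ultimately have "1 - 2 ^ (l k + 1) * real (l k) ^ l k / s \<le> ?Pr k (\<theta> k)"
        using fin_field.prob_rich_flat_ge[OF field assms(7,9,12)] \<theta>(2) s(1) by blast
      moreover have "2 ^ (l k + 1) * real (l k) ^ l k / s \<le> C / s"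
        using C s by (intro divide_right_mono) simp_all
      moreover have "?Pr k (\<theta> k) \<le> 1" by (simp add: prob_rich_flat_def)
      ultimately show ?case using s by (simp add: dist_real_def)
    qed
  qed
  show ?thesis
    unfolding threshold_function_def t_def[symmetric, unfolded N_def]
    using zero one by blast
qed

end
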